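(* Let $\alpha\geq 0$, let $b>0$ and let $\Omega\subset\mathbb{R}^+$ be a measurable subset. Suppose there exists a constant $c>0$ such that, for every $f\in L^2_\alpha(\mathbb{R}^+)$ with $\mathrm{supp}\,\mathcal{F}_\alpha(f)\subset[0,b]$, $$c\int_0^\infty|f(x)|^2\,d\mu_\alpha(x)\ \leq\ \int_\Omega|f(x)|^2\,d\mu_\alpha(x).$$ Then $\Omega$ is relatively dense, i.e. there exist $\gamma,a>0$ such that $\mu_\alpha(\Omega\cap[x-a,x+a])\geq\gamma\,\mu_\alpha([x-a,x+a])$ for all $x\geq a$.
   Context: Here $\mathbb{R}^+=[0,\infty)$. For $\alpha>-1/2$, let $d\mu_\alpha(x)=\frac{2\pi^{\alpha+1}}{\Gamma(\alpha+1)}x^{2\alpha+1}\,dx$ on $\mathbb{R}^+$. For $1\le p<\infty$, $L^p_\alpha(\mathbb{R}^+)$ is the space of (complex-valued) measurable functions on $\mathbb{R}^+$ with $\|f\|_{L^p_\alpha}=\left(\int_0^\infty|f|^p\,d\mu_\alpha\right)^{1/p}<\infty$. The Fourier-Bessel (Hankel) transform of $f\in L^1_\alpha(\mathbb{R}^+)$ is $\mathcal{F}_\alpha(f)(y)=\int_0^\infty f(x)\,j_\alpha(2\pi xy)\,d\mu_\alpha(x)$, where $j_\alpha(x)=\Gamma(\alpha+1)\sum_{n=0}^\infty\frac{(-1)^n}{n!\,\Gamma(n+\alpha+1)}\left(\frac{x}{2}\right)^{2n}$. It extends from $L^1_\alpha\cap L^2_\alpha$ to an isometry of $L^2_\alpha(\mathbb{R}^+)$,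 still denoted $\mathcal{F}_\alpha$. The condition $\mathrm{supp}\,\mathcal{F}_\alpha(f)\subset[0,b]$ means $\mathcal{F}_\alpha(f)=0$ almost everywhere outside $[0,b]$. *)

theory Defs
  imports "HOL-Analysis.Analysis"
begin

text \<open>
  The measure \<open>\<mu>\<^sub>\<alpha>\<close> lives on the Lebesgue measurable subsets of
  \<open>[0, \<infinity>)\<close>: its space is \<open>{0..}\<close>, so the values of a function at negative
  arguments are irrelevant to measurability and to integrals.
\<close>

definition fb_measure :: "real \<Rightarrow> real measure" where
  "fb_measure \<alpha> = density (lebesgue_on {0..})
     (\<lambda>x. ennreal (2 * pi powr (\<alpha> + 1) / Gamma (\<alpha> + 1) * x powr (2 * \<alpha> + 1)))"

definition fb_Lp :: "real \<Rightarrow> real \<Rightarrow> (real \<Rightarrow> complex) set" where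
  "fb_Lp \<alpha> p = {f \<in> borel_measurable (fb_measure \<alpha>).
                   integrable (fb_measure \<alpha>) (\<lambda>x. cmod (f x) powr p)}"

definition fb_norm :: "real \<Rightarrow> real \<Rightarrow> (real \<Rightarrow> complex) \<Rightarrow> real" where
  "fb_norm \<alpha> p f = (LINT x|fb_measure \<alpha>. cmod (f x) powr p) powr (1 / p)"

text \<open>
  Membership in the space is part of convergence, because \<^const>\<open>fb_norm\<close> is \<open>0\<close>
  when the integral diverges.
\<close>

definition fb_converges ::
    "real \<Rightarrow> real \<Rightarrow> (nat \<Rightarrow> real \<Rightarrow> complex) \<Rightarrow> (real \<Rightarrow> complex) \<Rightarrow> bool" where
  "fb_converges \<alpha> p h f \<longleftrightarrow>
     (\<forall>n. h n \<in> fb_Lp \<alpha> p) \<and> f \<in> fb_Lp \<alpha> p \<and>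
     (\<lambda>n. fb_norm \<alpha> p (\<lambda>x. h n x - f x)) \<longlonglongrightarrow> 0"

definition bessel_j :: "real \<Rightarrow> real \<Rightarrow> real" where
  "bessel_j \<alpha> x = Gamma (\<alpha> + 1) *
     (\<Sum>n. (-1) ^ n / (fact n * Gamma (real n + \<alpha> + 1)) * (x / 2) ^ (2 * n))"

definition fourier_bessel :: "real \<Rightarrow> (real \<Rightarrow> complex) \<Rightarrow> real \<Rightarrow> complex" where
  "fourier_bessel \<alpha> f y =
     (LINT x|fb_measure \<alpha>. f x * complex_of_real (bessel_j \<alpha> (2 * pi * x * y)))"

text \<open>
  The extension of the transform from \<open>L\<^sup>1 \<inter> L\<^sup>2\<close> to \<open>L\<^sup>2\<close> by continuity. Functions
  are not identified almost everywhere, so the transform of \<open>f\<close> is only determined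
  up to a null set, and the extension is given by its graph: \<open>g\<close> is a
  representative of the transform of \<open>f\<close>. By Plancherel's theorem every \<open>f\<close> in
  \<open>L\<^sup>2\<close> has such a \<open>g\<close>, unique up to a null set.
\<close>

definition has_fourier_bessel_L2 ::
    "real \<Rightarrow> (real \<Rightarrow> complex) \<Rightarrow> (real \<Rightarrow> complex) \<Rightarrow> bool" where
  "has_fourier_bessel_L2 \<alpha> f g \<longleftrightarrow>
     (\<exists>h. (\<forall>n. h n \<in> fb_Lp \<alpha> 1 \<inter> fb_Lp \<alpha> 2) \<and>
          fb_converges \<alpha> 2 h f \<and>
          fb_converges \<alpha> 2 (\<lambda>n. fourier_bessel \<alpha> (h n)) g)"

definition fb_supp_within :: "real \<Rightarrow> (real \<Rightarrow> complex) \<Rightarrow> real set \<Rightarrow> bool" where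
  "fb_supp_within \<alpha> f S \<longleftrightarrow>
     (\<exists>g. has_fourier_bessel_L2 \<alpha> f g \<and> (AE y in fb_measure \<alpha>. y \<notin> S \<longrightarrow> g y = 0))"

definition relatively_dense :: "real \<Rightarrow> real set \<Rightarrow> bool" where
  "relatively_dense \<alpha> \<Omega> \<longleftrightarrow>
     (\<exists>\<gamma>>0. \<exists>a>0. \<forall>x\<ge>a.
        measure (fb_measure \<alpha>) (\<Omega> \<inter> {x - a..x + a}) \<ge>
          \<gamma> * measure (fb_measure \<alpha>) {x - a..x + a})"

end

theory Submission
  imports Defs
begin

text \<open>
  Why the theorem holds. The hypothesis is tested on wave packets. Fix a smooth bump \<open>\<psi>\<close> supported in
  \<open>[b/2, b]\<close> and let \<open>f\<close> be the transform of \<open>\<psi>(y) cos(2\<pi> x\<^sub>0 y - \<theta>)\<close>, which has spectrum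
  in \<open>[0, b]\<close>. Three facts about \<open>f\<close> hold uniformly in \<open>x\<^sub>0 \<ge> 1\<close>.

  Energy. By Plancherel the packets for \<open>\<theta> = 0\<close> and \<open>\<theta> = \<pi>/2\<close> together have energy
  \<open>\<integral> \<psi>\<^sup>2 d\<mu>\<close>, because \<open>cos\<^sup>2 + sin\<^sup>2 = 1\<close> (\<open>packet_energy\<close>).

  Concentration at \<open>x\<^sub>0\<close>. The function \<open>j\<^sub>\<alpha>(2\<pi> x \<cdot>)\<close> is an eigenfunction of
  \<open>L = d\<^sup>2/dy\<^sup>2 + (2\<alpha>+1)/y d/dy\<close> with eigenvalue \<open>-(2\<pi> x)\<^sup>2\<close>, so multiplying \<open>f\<close> by
  \<open>4\<pi>\<^sup>2(x\<^sub>0\<^sup>2 - x\<^sup>2)\<close> amounts to applying \<open>L + (2\<pi> x\<^sub>0)\<^sup>2\<close> to the packet. The second derivative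
  of the cosine cancels, and what remains is of size \<open>x\<^sub>0\<close>. By Plancherel
  \<open>\<integral> (x\<^sup>2 - x\<^sub>0\<^sup>2)\<^sup>2 f\<^sup>2 d\<mu> \<le> T x\<^sub>0\<^sup>2\<close>, and since \<open>\<bar>x\<^sup>2 - x\<^sub>0\<^sup>2\<bar> \<ge> R x\<^sub>0\<close> for
  \<open>\<bar>x - x\<^sub>0\<bar> \<ge> R\<close>, the energy further than \<open>R\<close> from \<open>x\<^sub>0\<close> is at most \<open>T/R\<^sup>2\<close>
  (\<open>packet_concentration\<close>).

  Pointwise size. Since \<open>z powr (2\<alpha>+1) j\<^sub>\<alpha>(z)\<^sup>2\<close> is bounded, so is \<open>x powr (2\<alpha>+1) f(x)\<^sup>2\<close>
  (\<open>packet_decay\<close>).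

  Insert \<open>f\<close> in the hypothesis and take \<open>R\<close> so large that the energy away from \<open>x\<^sub>0\<close> is absorbed on
  the left. The energy left on \<open>\<Omega>\<close> near \<open>x\<^sub>0\<close> is at most a constant times
  \<open>\<mu>(\<Omega> \<inter> I) / x\<^sub>0 powr (2\<alpha>+1)\<close> for an interval \<open>I\<close> of fixed length about \<open>x\<^sub>0\<close>, and
  \<open>\<mu>(I)\<close> is at most a constant times \<open>x\<^sub>0 powr (2\<alpha>+1)\<close>.

  Plancherel's theorem (\<open>hankel_plancherel\<close>) for continuous functions of bounded support
  comes from Gaussians: the transform of \<open>exp (- \<pi> t x\<^sup>2)\<close> is
  \<open>t powr (- \<alpha> - 1) exp (- \<pi> y\<^sup>2 / t)\<close>, which
  gives inversion and Parseval's identity for finite sums of Gaussians in closed form, and in the variable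
  \<open>u = exp (- \<pi> x\<^sup>2)\<close> the sums with integer \<open>t\<close> are polynomials, so Weierstrass' theorem makes them dense.
\<close>

section \<open>The normalised Bessel function\<close>

definition bessel_coeff :: "real \<Rightarrow> nat \<Rightarrow> real" where
  "bessel_coeff \<alpha> n = (-1) ^ n / (fact n * pochhammer (\<alpha> + 1) n)"

definition bessel_series :: "real \<Rightarrow> real \<Rightarrow> real" where
  "bessel_series \<alpha> w = (\<Sum>n. bessel_coeff \<alpha> n * w ^ n)"

definition bessel_series_deriv :: "real \<Rightarrow> real \<Rightarrow> real" where
  "bessel_series_deriv \<alpha> w = (\<Sum>n. diffs (bessel_coeff \<alpha>) n * w ^ n)"

definition bessel_dj :: "real \<Rightarrow> real \<Rightarrow> real" where
  "bessel_dj \<alpha> z = z / 2 * bessel_series_deriv \<alpha> (z\<^sup>2 / 4)"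

lemma pochhammer_ge_1:
  assumes "\<alpha> \<ge> (0::real)"
  shows "pochhammer (\<alpha> + 1) n \<ge> 1"
proof (induction n)
  case (Suc n)
  have "1 * 1 \<le> pochhammer (\<alpha> + 1) n * (\<alpha> + 1 + real n)"
    using Suc assms by (intro mult_mono) auto
  then show ?case by (simp add: pochhammer_Suc)
qed simp

lemma Gamma_shift_pochhammer:
  assumes "\<alpha> \<ge> (0::real)"
  shows "Gamma (real n + \<alpha> + 1) = pochhammer (\<alpha> + 1) n * Gamma (\<alpha> + 1)"
proof -
  have "\<alpha> + 1 \<notin> \<int>\<^sub>\<le>\<^sub>0"
    using assms by (auto elim!: nonpos_Ints_cases)
  moreover have "Gamma (\<alpha> + 1) > 0"
    using assms by (intro Gamma_real_pos) auto
  ultimately show ?thesis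
    using pochhammer_Gamma[of "\<alpha> + 1" n] by (simp add: field_simps)
qed

lemma abs_bessel_coeff_le:
  assumes "\<alpha> \<ge> 0"
  shows "\<bar>bessel_coeff \<alpha> n\<bar> \<le> 1 / fact n"
proof -
  have "1 * 1 \<le> fact n * pochhammer (\<alpha> + 1) n / (fact n :: real)"
    using pochhammer_ge_1[OF assms] by simp
  then show ?thesis
    using pochhammer_ge_1[OF assms, of n]
    by (simp add: bessel_coeff_def abs_mult field_simps)
qed

lemma summable_bessel:
  assumes "\<alpha> \<ge> 0"
  shows "summable (\<lambda>n. bessel_coeff \<alpha> n * w ^ n)"
proof (rule summable_comparison_test')
  show "summable (\<lambda>n. inverse (fact n) * \<bar>w\<bar> ^ n)"
    by (rule summable_exp)
  show "norm (bessel_coeff \<alpha> n * w ^ n) \<le> inverse (fact n) * \<bar>w\<bar> ^ n" if "n \<ge> 0" for n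
    using mult_right_mono[OF abs_bessel_coeff_le[OF assms, of n], of "\<bar>w\<bar> ^ n"]
    by (simp add: abs_mult power_abs inverse_eq_divide)
qed

lemma bessel_j_eq_series:
  assumes "\<alpha> \<ge> 0"
  shows "bessel_j \<alpha> z = bessel_series \<alpha> (z\<^sup>2 / 4)"
proof -
  have G: "Gamma (\<alpha> + 1) > 0"
    using assms by (intro Gamma_real_pos) auto
  have *: "Gamma (\<alpha> + 1) * ((-1) ^ n / (fact n * Gamma (real n + \<alpha> + 1)) * (z / 2) ^ (2 * n))
      = bessel_coeff \<alpha> n * (z\<^sup>2 / 4) ^ n" for n
    using G by (simp add: Gamma_shift_pochhammer[OF assms] bessel_coeff_def power_mult power_divide)
  have "summable (\<lambda>n. Gamma (\<alpha> + 1) *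
      ((-1) ^ n / (fact n * Gamma (real n + \<alpha> + 1)) * (z / 2) ^ (2 * n)))"
    unfolding * by (rule summable_bessel[OF assms])
  then have "summable (\<lambda>n. (-1) ^ n / (fact n * Gamma (real n + \<alpha> + 1)) * (z / 2) ^ (2 * n))"
    using G by (simp only: summable_cmult_iff) simp
  from suminf_mult[OF this, of "Gamma (\<alpha> + 1)"] show ?thesis
    unfolding bessel_j_def bessel_series_def * by simp
qed

lemma DERIV_bessel_series:
  assumes "\<alpha> \<ge> 0"
  shows "(bessel_series \<alpha> has_real_derivative bessel_series_deriv \<alpha> w) (at w)"
  unfolding bessel_series_def[abs_def] bessel_series_deriv_def
  by (rule termdiffs_strong_converges_everywhere) (rule summable_bessel[OF assms])

text \<open>
  In the variable \<open>w = z\<^sup>2/4\<close> Bessel's equation reads \<open>w \<phi>'' + (\<alpha>+1) \<phi>' + \<phi> = 0\<close>. For a power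
  series \<open>\<Sum> c\<^sub>n w\<^sup>n\<close> this is the recursion \<open>(n+1)(n+\<alpha>+1) c\<^sub>n\<^sub>+\<^sub>1 + c\<^sub>n = 0\<close>.
\<close>

lemma bessel_series_ode:
  assumes "\<alpha> \<ge> 0"
  obtains D where "(bessel_series_deriv \<alpha> has_real_derivative D) (at w)"
    and "w * D + (\<alpha> + 1) * bessel_series_deriv \<alpha> w + bessel_series \<alpha> w = 0"
proof
  let ?c = "bessel_coeff \<alpha>"
  let ?D = "\<Sum>n. diffs (diffs ?c) n * w ^ n"
  have s1: "summable (\<lambda>n. diffs ?c n * w ^ n)" for w
    using summable_bessel[OF assms] by (rule termdiff_converges_all)
  have s2: "summable (\<lambda>n. diffs (diffs ?c) n * w ^ n)" for w
    using s1 by (rule termdiff_converges_all)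
  show "(bessel_series_deriv \<alpha> has_real_derivative ?D) (at w)"
    unfolding bessel_series_deriv_def[abs_def]
    by (rule termdiffs_strong_converges_everywhere) (rule s1)
  let ?f = "\<lambda>n. real n * diffs ?c n * w ^ n"
  have "(\<lambda>n. w * (diffs (diffs ?c) n * w ^ n)) sums (w * ?D)"
    by (intro sums_mult summable_sums s2)
  moreover have "w * (diffs (diffs ?c) n * w ^ n) = ?f (Suc n)" for n
    by (simp add: diffs_def)
  ultimately have "?f sums (w * ?D)"
    using sums_Suc_iff[of ?f "w * ?D"] by simp
  moreover have "(\<lambda>n. (\<alpha> + 1) * (diffs ?c n * w ^ n)) sums ((\<alpha> + 1) * bessel_series_deriv \<alpha> w)"
    unfolding bessel_series_deriv_def by (intro sums_mult summable_sums s1)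
  moreover have "(\<lambda>n. ?c n * w ^ n) sums bessel_series \<alpha> w"
    unfolding bessel_series_def by (intro summable_sums summable_bessel[OF assms])
  ultimately have "(\<lambda>n. ?f n + (\<alpha> + 1) * (diffs ?c n * w ^ n) + ?c n * w ^ n)
      sums (w * ?D + (\<alpha> + 1) * bessel_series_deriv \<alpha> w + bessel_series \<alpha> w)"
    by (intro sums_add)
  moreover have "?f n + (\<alpha> + 1) * (diffs ?c n * w ^ n) + ?c n * w ^ n = 0" for n
  proof -
    have "pochhammer (\<alpha> + 1) n > 0"
      using pochhammer_ge_1[OF assms, of n] by simp
    moreover have "\<alpha> + 1 + real n > 0"
      using assms by simp
    ultimately have "(real n + \<alpha> + 1) * diffs ?c n + ?c n = 0"
      by (simp add: diffs_def bessel_coeff_def pochhammer_Suc divide_simps) (simp add: algebra_simps)?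
    then have "((real n + \<alpha> + 1) * diffs ?c n + ?c n) * w ^ n = 0"
      by simp
    then show ?thesis
      by (simp add: algebra_simps)
  qed
  ultimately have "(\<lambda>n. 0) sums (w * ?D + (\<alpha> + 1) * bessel_series_deriv \<alpha> w + bessel_series \<alpha> w)"
    by simp
  then show "w * ?D + (\<alpha> + 1) * bessel_series_deriv \<alpha> w + bessel_series \<alpha> w = 0"
    using sums_unique2 sums_zero by blast
qed

lemma DERIV_bessel_j:
  assumes "\<alpha> \<ge> 0"
  shows "(bessel_j \<alpha> has_real_derivative bessel_dj \<alpha> z) (at z)"
proof -
  have "((\<lambda>z. bessel_series \<alpha> (z\<^sup>2 / 4)) has_real_derivative
      bessel_series_deriv \<alpha> (z\<^sup>2 / 4) * (2 * z / 4)) (at z)"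
    by (rule DERIV_chain2[OF DERIV_bessel_series[OF assms]])
       (auto intro!: derivative_eq_intros)
  then show ?thesis
    by (simp add: bessel_j_eq_series[OF assms, abs_def] bessel_dj_def mult.commute)
qed

text \<open>
  Bessel's equation \<open>j'' + (2\<alpha>+1)/z j' + j = 0\<close>, multiplied by \<open>z\<close> so that it also makes sense at \<open>0\<close>.
\<close>

lemma bessel_ode:
  assumes "\<alpha> \<ge> 0"
  obtains D where "(bessel_dj \<alpha> has_real_derivative D) (at z)"
    and "z * D = - z * bessel_j \<alpha> z - (2 * \<alpha> + 1) * bessel_dj \<alpha> z"
proof -
  obtain E where E: "(bessel_series_deriv \<alpha> has_real_derivative E) (at (z\<^sup>2 / 4))"
    and ode: "z\<^sup>2 / 4 * E + (\<alpha> + 1) * bessel_series_deriv \<alpha> (z\<^sup>2 / 4)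
               + bessel_series \<alpha> (z\<^sup>2 / 4) = 0"
    using bessel_series_ode[OF assms] by blast
  have "((\<lambda>z. bessel_series_deriv \<alpha> (z\<^sup>2 / 4)) has_real_derivative E * (2 * z / 4)) (at z)"
    by (rule DERIV_chain2[where g = "\<lambda>z. z\<^sup>2 / 4" and f = "bessel_series_deriv \<alpha>", OF E])
       (auto intro!: derivative_eq_intros)
  then have "((\<lambda>z. z / 2 * bessel_series_deriv \<alpha> (z\<^sup>2 / 4)) has_real_derivative
      z / 2 * (E * (2 * z / 4)) + 1 / 2 * bessel_series_deriv \<alpha> (z\<^sup>2 / 4)) (at z)"
    by (auto intro!: derivative_eq_intros)
  then have "(bessel_dj \<alpha> has_real_derivative
      z / 2 * (E * (2 * z / 4)) + 1 / 2 * bessel_series_deriv \<alpha> (z\<^sup>2 / 4)) (at z)"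
    by (simp add: bessel_dj_def[abs_def])
  moreover have "z * (z / 2 * (E * (2 * z / 4)) + 1 / 2 * bessel_series_deriv \<alpha> (z\<^sup>2 / 4))
      = - z * bessel_j \<alpha> z - (2 * \<alpha> + 1) * bessel_dj \<alpha> z"
  proof -
    have j: "bessel_j \<alpha> z = - (z\<^sup>2 / 4 * E + (\<alpha> + 1) * bessel_series_deriv \<alpha> (z\<^sup>2 / 4))"
      using ode bessel_j_eq_series[OF assms, of z] by linarith
    show ?thesis
      unfolding bessel_dj_def j by (simp add: power2_eq_square field_simps)
  qed
  ultimately show thesis
    using that by blast
qed

lemma continuous_bessel_j:
  assumes "\<alpha> \<ge> 0"
  shows "continuous_on UNIV (bessel_j \<alpha>)" "continuous_on UNIV (bessel_dj \<alpha>)"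
proof -
  show "continuous_on UNIV (bessel_j \<alpha>)"
    using DERIV_bessel_j[OF assms] by (intro DERIV_continuous_on) auto
  show "continuous_on UNIV (bessel_dj \<alpha>)"
    unfolding continuous_on_eq_continuous_at[OF open_UNIV]
    using bessel_ode[OF assms] by (metis DERIV_isCont)
qed

text \<open>
  The equation is a damped oscillator: \<open>j\<^sup>2 + j'\<^sup>2\<close> has derivative \<open>-2(2\<alpha>+1) j'\<^sup>2/z \<le> 0\<close> and starts
  at \<open>1\<close>.
\<close>

lemma bessel_energy_le:
  assumes "\<alpha> \<ge> 0" "z \<ge> 0"
  shows "(bessel_j \<alpha> z)\<^sup>2 + (bessel_dj \<alpha> z)\<^sup>2 \<le> 1"
proof -
  let ?j = "bessel_j \<alpha>" and ?d = "bessel_dj \<alpha>"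
  let ?E = "\<lambda>z. (?j z)\<^sup>2 + (?d z)\<^sup>2"
  have "?E z \<le> ?E 0"
  proof (rule DERIV_nonpos_imp_decreasing_open[OF \<open>z \<ge> 0\<close>])
    fix x :: real assume "0 < x" "x < z"
    obtain D where D: "(?d has_real_derivative D) (at x)"
      "x * D = - x * ?j x - (2 * \<alpha> + 1) * ?d x"
      using bessel_ode[OF assms(1)] by blast
    have "x * (2 * ?j x * ?d x + 2 * ?d x * D) = 2 * ?d x * (x * ?j x + x * D)"
      by (simp add: algebra_simps)
    also have "\<dots> = - 2 * (2 * \<alpha> + 1) * (?d x)\<^sup>2"
      unfolding D(2) by (simp add: power2_eq_square algebra_simps)
    also have "\<dots> \<le> 0"
      using assms(1) by (intro mult_nonpos_nonneg) auto
    finally have "2 * ?j x * ?d x + 2 * ?d x * D \<le> 0"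
      using \<open>0 < x\<close> by (simp add: mult_le_0_iff)
    moreover have "(?E has_real_derivative 2 * ?j x * ?d x + 2 * ?d x * D) (at x)"
      using D(1) DERIV_bessel_j[OF assms(1)]
      by (auto intro!: derivative_eq_intros simp: algebra_simps)
    ultimately show "\<exists>y. (?E has_real_derivative y) (at x) \<and> y \<le> 0"
      by blast
  qed (intro continuous_intros continuous_on_subset[OF continuous_bessel_j(1)[OF assms(1)]]
         continuous_on_subset[OF continuous_bessel_j(2)[OF assms(1)]] subset_UNIV)
  also have "?E 0 = 1"
  proof -
    have "bessel_series \<alpha> 0 = 1"
      unfolding bessel_series_def powser_zero by (simp add: bessel_coeff_def)
    then show ?thesis
      by (simp add: bessel_j_eq_series[OF assms(1)] bessel_dj_def)
  qed
  finally show ?thesis .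
qed

lemma abs_bessel_j_le_1:
  assumes "\<alpha> \<ge> 0"
  shows "\<bar>bessel_j \<alpha> z\<bar> \<le> 1"
proof -
  have "bessel_j \<alpha> z = bessel_j \<alpha> \<bar>z\<bar>"
    by (simp add: bessel_j_eq_series[OF assms])
  moreover have "(bessel_j \<alpha> \<bar>z\<bar>)\<^sup>2 \<le> 1"
    using bessel_energy_le[OF assms, of "\<bar>z\<bar>"] by (smt (verit) abs_ge_zero zero_le_power2)
  ultimately show ?thesis
    by (simp add: abs_square_le_1)
qed

text \<open>
  Put \<open>m = 2\<alpha>+1\<close>. The energy \<open>z powr m (j\<^sup>2 + j'\<^sup>2)\<close> has derivative \<open>m z powr (m-1) (j\<^sup>2 - j'\<^sup>2)\<close>, of
  varying sign. Adding \<open>m z powr (m-1) j j'\<close> cancels this term: the sum \<open>E\<close> satisfies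
  \<open>E' = - m z powr (m-2) j j'\<close>, which for \<open>z \<ge> m\<close> is at most \<open>(m/z\<^sup>2) E\<close>. As \<open>m/z\<^sup>2\<close> is integrable at
  infinity, \<open>E\<close> stays bounded; \<open>exp (m/z)\<close> is the integrating factor.
\<close>

lemma bessel_j_decay:
  assumes "\<alpha> \<ge> 0"
  obtains C where "C > 0" "\<And>z. z \<ge> 0 \<Longrightarrow> z powr (2 * \<alpha> + 1) * (bessel_j \<alpha> z)\<^sup>2 \<le> C"
proof -
  let ?j = "bessel_j \<alpha>" and ?d = "bessel_dj \<alpha>"
  define m where "m = 2 * \<alpha> + 1"
  have m: "m \<ge> 1" using assms by (simp add: m_def)
  define E where "E = (\<lambda>z. z powr m * ((?j z)\<^sup>2 + (?d z)\<^sup>2 + m * ?j z * ?d z / z))"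
  define H where "H = (\<lambda>z. E z * exp (m / z))"
  \<comment> \<open>For \<open>z \<ge> m\<close> the correction is at most half of the main term.\<close>
  have low: "z powr m * ((?j z)\<^sup>2 + (?d z)\<^sup>2) \<le> 2 * E z" if "z \<ge> m" for z
  proof -
    have z: "z > 0" using that m by linarith
    have "\<bar>m * ?j z * ?d z / z\<bar> = m / z * \<bar>?j z * ?d z\<bar>"
      using m z by (simp add: abs_mult)
    also have "\<dots> \<le> 1 * \<bar>?j z * ?d z\<bar>"
      using m z that by (intro mult_right_mono) auto
    also have "\<dots> \<le> ((?j z)\<^sup>2 + (?d z)\<^sup>2) / 2"
      using sum_squares_bound[of "?j z" "?d z"] sum_squares_bound[of "?j z" "- ?d z"]
      by (simp add: abs_if)
    finally have *: "\<bar>m * ?j z * ?d z / z\<bar> \<le> ((?j z)\<^sup>2 + (?d z)\<^sup>2) / 2" .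
    have "s \<le> 2 * (s + a)" if "\<bar>a\<bar> \<le> s / 2" for a s :: real
      using that by (auto simp: abs_le_iff)
    note this[OF *]
    from mult_left_mono[OF this, of "z powr m"] show ?thesis
      by (simp add: E_def algebra_simps)
  qed
  have dH: "\<exists>y. (H has_real_derivative y) (at x) \<and> y \<le> 0" if "x \<ge> m" for x
  proof -
    have x: "x > 0" using that m by linarith
    obtain D where D: "(?d has_real_derivative D) (at x)"
      "x * D = - x * ?j x - m * ?d x"
      using bessel_ode[OF assms(1)] unfolding m_def by blast
    have D': "D = - ?j x - m * ?d x / x"
      using D(2) x by (simp add: field_simps)
    have dQ: "((\<lambda>z. (?j z)\<^sup>2 + (?d z)\<^sup>2 + m * ?j z * ?d z / z) has_real_derivative
        2 * ?j x * ?d x + 2 * ?d x * D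
            + ((m * ?d x * ?d x + m * ?j x * D) * x - m * ?j x * ?d x) / (x * x)) (at x)"
      by (rule derivative_eq_intros refl D(1) DERIV_bessel_j[OF assms(1)] | use x in simp)+
    have "(E has_real_derivative
        x powr m * (2 * ?j x * ?d x + 2 * ?d x * D
            + ((m * ?d x * ?d x + m * ?j x * D) * x - m * ?j x * ?d x) / (x * x))
        + m * x powr (m - 1) * ((?j x)\<^sup>2 + (?d x)\<^sup>2 + m * ?j x * ?d x / x)) (at x)"
      unfolding E_def by (rule DERIV_mult'[OF has_real_derivative_powr[OF x] dQ])
    also have "x powr m * (2 * ?j x * ?d x + 2 * ?d x * D
            + ((m * ?d x * ?d x + m * ?j x * D) * x - m * ?j x * ?d x) / (x * x))
        + m * x powr (m - 1) * ((?j x)\<^sup>2 + (?d x)\<^sup>2 + m * ?j x * ?d x / x)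
        = - m * x powr m * (?j x * ?d x) / (x * x)"
    proof -
      have p: "x powr (m - 1) = x powr m / x"
        using x powr_diff[of x m 1] by simp
      have "P * (2 * j * d + 2 * d * (- j - m * d / x)
            + ((m * d * d + m * j * (- j - m * d / x)) * x - m * j * d) / (x * x))
          + m * (P / x) * (j\<^sup>2 + d\<^sup>2 + m * j * d / x) = - m * P * (j * d) / (x * x)" for P j d :: real
        using x by (simp add: field_simps power2_eq_square)
      then show ?thesis
        unfolding D' p .
    qed
    finally have dE: "(E has_real_derivative - m * x powr m * (?j x * ?d x) / (x * x)) (at x)" .
    have "(H has_real_derivative
        exp (m / x) * (- m * x powr m * (?j x * ?d x) / (x * x) - m / (x * x) * E x)) (at x)"
      unfolding H_def using dE x
      by (auto intro!: derivative_eq_intros simp: algebra_simps)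
    moreover have "- m * x powr m * (?j x * ?d x) / (x * x) \<le> m / (x * x) * E x"
    proof -
      have "- (?j x * ?d x) \<le> ((?j x)\<^sup>2 + (?d x)\<^sup>2) / 2"
        using sum_squares_bound[of "?j x" "- ?d x"] by simp
      then have "x powr m * (- (?j x * ?d x)) \<le> x powr m * (((?j x)\<^sup>2 + (?d x)\<^sup>2) / 2)"
        by (intro mult_left_mono) auto
      also have "\<dots> \<le> E x"
        using low[OF that] by simp
      finally have "m / (x * x) * (x powr m * (- (?j x * ?d x))) \<le> m / (x * x) * E x"
        using m by (intro mult_left_mono) auto
      then show ?thesis by (simp add: algebra_simps)
    qed
    then have "exp (m / x) * (- m * x powr m * (?j x * ?d x) / (x * x) - m / (x * x) * E x) \<le> 0"
      by (intro mult_nonneg_nonpos) auto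
    ultimately show ?thesis by blast
  qed
  define C where "C = max (2 * H m) (m powr m) + 1"
  have "z powr (2 * \<alpha> + 1) * (?j z)\<^sup>2 \<le> C" if "z \<ge> 0" for z
  proof (cases "z \<ge> m")
    case True
    then have z: "z > 0" using m by linarith
    have "z powr m * (?j z)\<^sup>2 \<le> z powr m * ((?j z)\<^sup>2 + (?d z)\<^sup>2)"
      by (intro mult_left_mono) auto
    also have "\<dots> \<le> 2 * E z"
      by (rule low[OF True])
    also have "\<dots> \<le> 2 * H z"
    proof -
      have "0 \<le> z powr m * ((?j z)\<^sup>2 + (?d z)\<^sup>2)" by simp
      then have "E z \<ge> 0" using low[OF True] by linarith
      then have "E z * 1 \<le> E z * exp (m / z)"
        using m z by (intro mult_left_mono) auto
      then show ?thesis by (simp add: H_def)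
    qed
    also have "H z \<le> H m"
      by (rule DERIV_nonpos_imp_nonincreasing[OF True]) (rule dH)
    finally show ?thesis
      by (simp add: C_def m_def)
  next
    case False
    have "z powr m * (?j z)\<^sup>2 \<le> m powr m * 1"
    proof (intro mult_mono)
      show "z powr m \<le> m powr m"
        using False that m by (intro powr_mono2) auto
      show "(?j z)\<^sup>2 \<le> 1"
        using abs_bessel_j_le_1[OF assms] by (simp add: abs_square_le_1)
    qed auto
    then show ?thesis
      by (simp add: C_def m_def)
  qed
  moreover have "C > 0"
    unfolding C_def by (smt (verit) powr_ge_zero)
  ultimately show thesis using that by blast
qed

section \<open>Gaussians under the Fourier-Bessel transform\<close>

definition fb_weight :: "real \<Rightarrow> real \<Rightarrow> real" where
  "fb_weight \<alpha> x = 2 * pi powr (\<alpha> + 1) / Gamma (\<alpha> + 1) * x powr (2 * \<alpha> + 1)"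

lemma fb_measure_eq: "fb_measure \<alpha> = density (lebesgue_on {0..}) (\<lambda>x. ennreal (fb_weight \<alpha> x))"
  by (simp add: fb_measure_def fb_weight_def)

lemma space_fb_measure [simp]: "space (fb_measure \<alpha>) = {0..}"
  by (simp add: fb_measure_def)

lemma sets_fb_measure: "sets (fb_measure \<alpha>) = sets (lebesgue_on {0..})"
  by (simp add: fb_measure_def)

lemma borel_measurable_lebesgue_on:
  assumes "f \<in> borel_measurable borel"
  shows "f \<in> borel_measurable (lebesgue_on S)"
  using assms by (intro measurable_restrict_space1 measurable_completion) simp

lemma borel_measurable_fb_measure:
  assumes "f \<in> borel_measurable borel"
  shows "f \<in> borel_measurable (fb_measure \<alpha>)"
  using borel_measurable_lebesgue_on[OF assms, of "{0..}"] by (simp add: fb_measure_def)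

lemma fb_weight_nonneg:
  assumes "\<alpha> \<ge> 0"
  shows "fb_weight \<alpha> x \<ge> 0"
proof -
  have "Gamma (\<alpha> + 1) > 0"
    using assms by (intro Gamma_real_pos) auto
  then show ?thesis by (simp add: fb_weight_def)
qed

lemma borel_measurable_fb_weight [measurable]: "fb_weight \<alpha> \<in> borel_measurable borel"
  unfolding fb_weight_def[abs_def] by measurable

lemma has_bochner_integral_fb_measure:
  fixes f :: "real \<Rightarrow> real"
  assumes "\<alpha> \<ge> 0" "f \<in> borel_measurable borel"
    and "has_bochner_integral lebesgue (\<lambda>x. indicator {0..} x * (fb_weight \<alpha> x * f x)) I"
  shows "has_bochner_integral (fb_measure \<alpha>) f I"
  unfolding fb_measure_eq
proof (rule has_bochner_integral_density)
  show "f \<in> borel_measurable (lebesgue_on {0..})"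
    by (rule borel_measurable_lebesgue_on[OF assms(2)])
  show "fb_weight \<alpha> \<in> borel_measurable (lebesgue_on {0..})"
    by (rule borel_measurable_lebesgue_on) measurable
  show "AE x in lebesgue_on {0..}. 0 \<le> fb_weight \<alpha> x"
    by (simp add: fb_weight_nonneg[OF assms(1)])
  show "has_bochner_integral (lebesgue_on {0..}) (\<lambda>x. fb_weight \<alpha> x *\<^sub>R f x) I"
    using assms(3) by (subst has_bochner_integral_restrict_space) auto
qed

text \<open>
  Substituting \<open>u = t x\<^sup>2\<close> turns the integral into Euler's integral for \<open>\<Gamma>(s)\<close>.
\<close>

lemma has_bochner_integral_gaussian_power:
  fixes s t :: real
  assumes "s \<ge> 1" "t > 0"
  shows "has_bochner_integral lebesgue
     (\<lambda>x. indicator {0..} x * (x powr (2 * s - 1) * exp (- (t * x\<^sup>2)))) (Gamma s / (2 * t powr s))"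
proof -
  let ?f = "\<lambda>u. u powr (s - 1) / exp u" and ?g = "\<lambda>x. t * x\<^sup>2" and ?g' = "\<lambda>x. 2 * t * x"
  have im: "?g ` {0..} = {0..}"
  proof
    show "{0..} \<subseteq> ?g ` {0..}"
    proof
      fix u :: real assume "u \<in> {0..}"
      then have "u = ?g (sqrt (u / t))" "sqrt (u / t) \<in> {0..}"
        using assms(2) by auto
      then show "u \<in> ?g ` {0..}" by blast
    qed
  qed (use assms(2) in auto)
  have "inj_on ?g {0..}"
    using assms(2) by (auto intro!: inj_onI)
  moreover have "(?g has_real_derivative ?g' x) (at x within {0..})" for x
    by (auto intro!: derivative_eq_intros)
  moreover have "?f absolutely_integrable_on {0..} \<and> integral {0..} ?f = Gamma s"
  proof -
    have "(?f has_integral Gamma s) {0..}"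
      using assms(1) by (intro Gamma_integral_real) auto
    then show ?thesis
      by (auto intro!: nonnegative_absolutely_integrable_1 simp: integral_unique integrable_on_def)
  qed
  ultimately have *: "(\<lambda>x. \<bar>?g' x\<bar> * ?f (?g x)) absolutely_integrable_on {0..}"
      "integral {0..} (\<lambda>x. \<bar>?g' x\<bar> * ?f (?g x)) = Gamma s"
    using has_absolute_integral_change_of_variables_1'[of "{0..}" ?g ?g' ?f "Gamma s"]
    unfolding im by auto
  have "has_bochner_integral lebesgue (\<lambda>x. indicator {0..} x *\<^sub>R (\<bar>?g' x\<bar> * ?f (?g x))) (Gamma s)"
    using * set_lebesgue_integral_eq_integral(2)[OF *(1)]
    by (simp add: has_bochner_integral_iff set_integrable_def set_lebesgue_integral_def)
  from has_bochner_integral_mult_right[OF this, of "1 / (2 * t powr s)"]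
  have "has_bochner_integral lebesgue
      (\<lambda>x. 1 / (2 * t powr s) * (indicator {0..} x *\<^sub>R (\<bar>?g' x\<bar> * ?f (?g x)))) (Gamma s / (2 * t powr s))"
    by simp
  also have "(\<lambda>x. 1 / (2 * t powr s) * (indicator {0..} x *\<^sub>R (\<bar>?g' x\<bar> * ?f (?g x))))
      = (\<lambda>x. indicator {0..} x * (x powr (2 * s - 1) * exp (- (t * x\<^sup>2))))"
  proof
    fix x :: real
    show "1 / (2 * t powr s) * (indicator {0..} x *\<^sub>R (\<bar>?g' x\<bar> * ?f (?g x)))
      = indicator {0..} x * (x powr (2 * s - 1) * exp (- (t * x\<^sup>2)))"
    proof (cases "x > 0")
      case True
      have "(t * x\<^sup>2) powr (s - 1) = t powr s / t * (x powr (2 * s - 1) / x)"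
      proof -
        have "(x\<^sup>2) powr (s - 1) = x powr (2 * (s - 1))"
          using True by (simp add: powr_powr flip: powr_numeral)
        also have "\<dots> = x powr (2 * s - 1 - 1)"
          by (simp add: algebra_simps)
        also have "\<dots> = x powr (2 * s - 1) / x"
          using True by (subst powr_diff) auto
        finally have *: "(x\<^sup>2) powr (s - 1) = x powr (2 * s - 1) / x" .
        have "(t * x\<^sup>2) powr (s - 1) = t powr (s - 1) * (x\<^sup>2) powr (s - 1)"
          by (rule powr_mult)
        then show ?thesis
          unfolding * using assms(2) by (simp add: powr_diff[of t s 1])
      qed
      then show ?thesis
        using True assms(2) by (simp add: exp_minus field_simps)
    qed (auto simp: indicator_def)
  qed
  finally show ?thesis .
qed

text \<open>
  The normalisation of the measure is the one that makes the integral of \<open>exp (- \<pi> x\<^sup>2)\<close> equal to \<open>1\<close>. The higher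
  moments carry the factor \<open>(\<alpha>+1)\<^sub>n\<close> that cancels the one in the denominator of the Bessel coefficients.
\<close>

lemma gaussian_moment:
  assumes "\<alpha> \<ge> 0" "t > 0"
  shows "has_bochner_integral (fb_measure \<alpha>) (\<lambda>x. x ^ (2 * n) * exp (- (pi * t * x\<^sup>2)))
     (pochhammer (\<alpha> + 1) n / (pi * t) ^ n * t powr - (\<alpha> + 1))"
proof (rule has_bochner_integral_fb_measure[OF assms(1)])
  let ?s = "real n + \<alpha> + 1"
  let ?C = "2 * pi powr (\<alpha> + 1) / Gamma (\<alpha> + 1)"
  have G: "Gamma (\<alpha> + 1) > 0"
    using assms by (intro Gamma_real_pos) auto
  have "has_bochner_integral lebesgue
     (\<lambda>x. ?C * (indicator {0..} x * (x powr (2 * ?s - 1) * exp (- (pi * t * x\<^sup>2)))))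
     (?C * (Gamma ?s / (2 * (pi * t) powr ?s)))"
    using assms by (intro has_bochner_integral_mult_right has_bochner_integral_gaussian_power) auto
  also have "(\<lambda>x. ?C * (indicator {0..} x * (x powr (2 * ?s - 1) * exp (- (pi * t * x\<^sup>2)))))
      = (\<lambda>x. indicator {0..} x * (fb_weight \<alpha> x * (x ^ (2 * n) * exp (- (pi * t * x\<^sup>2)))))"
  proof
    fix x :: real
    have "x powr (2 * ?s - 1) = x powr (2 * \<alpha> + 1) * x ^ (2 * n)" if "x > 0"
      using that by (simp add: powr_add[symmetric] algebra_simps flip: powr_realpow)
    then show "?C * (indicator {0..} x * (x powr (2 * ?s - 1) * exp (- (pi * t * x\<^sup>2))))
      = indicator {0..} x * (fb_weight \<alpha> x * (x ^ (2 * n) * exp (- (pi * t * x\<^sup>2))))"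
      by (cases "x > 0") (auto simp: fb_weight_def indicator_def)
  qed
  also have "?C * (Gamma ?s / (2 * (pi * t) powr ?s))
      = pochhammer (\<alpha> + 1) n / (pi * t) ^ n * t powr - (\<alpha> + 1)"
  proof -
    have "(pi * t) powr ?s = (pi * t) ^ n * pi powr (\<alpha> + 1) * t powr (\<alpha> + 1)"
      using assms by (simp add: powr_add powr_mult powr_realpow algebra_simps)
    moreover have "t powr - (\<alpha> + 1) = 1 / t powr (\<alpha> + 1)"
      by (simp only: powr_minus_divide)
    ultimately show ?thesis
      using G assms(2) by (simp add: Gamma_shift_pochhammer[OF assms(1)] del: minus_add_distrib)
  qed
  finally show "has_bochner_integral lebesgue
     (\<lambda>x. indicator {0..} x * (fb_weight \<alpha> x * (x ^ (2 * n) * exp (- (pi * t * x\<^sup>2)))))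
     (pochhammer (\<alpha> + 1) n / (pi * t) ^ n * t powr - (\<alpha> + 1))" .
qed measurable

lemma gaussian_integral:
  assumes "\<alpha> \<ge> 0" "t > 0"
  shows "has_bochner_integral (fb_measure \<alpha>) (\<lambda>x. exp (- (pi * t * x\<^sup>2))) (t powr - (\<alpha> + 1))"
  using gaussian_moment[OF assms, of 0] by simp

text \<open>
  The test functions are real, and so are their transforms; working over the reals avoids coercions in
  the estimates.
\<close>

definition hankel :: "real \<Rightarrow> (real \<Rightarrow> real) \<Rightarrow> real \<Rightarrow> real" where
  "hankel \<alpha> g y = (LINT x|fb_measure \<alpha>. g x * bessel_j \<alpha> (2 * pi * x * y))"

lemma borel_measurable_bessel_j:
  assumes "\<alpha> \<ge> 0"
  shows "bessel_j \<alpha> \<in> borel_measurable borel"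
  by (rule borel_measurable_continuous_onI[OF continuous_bessel_j(1)[OF assms]])

lemma integrable_mult_bessel_j:
  assumes "\<alpha> \<ge> 0" "integrable (fb_measure \<alpha>) g"
  shows "integrable (fb_measure \<alpha>) (\<lambda>x. g x * bessel_j \<alpha> (2 * pi * x * y))"
proof (rule Bochner_Integration.integrable_bound[OF assms(2)])
  note [measurable] = borel_measurable_bessel_j[OF assms(1)]
  have "(\<lambda>x. bessel_j \<alpha> (2 * pi * x * y)) \<in> borel_measurable (fb_measure \<alpha>)"
    by (rule borel_measurable_fb_measure) measurable
  then show "(\<lambda>x. g x * bessel_j \<alpha> (2 * pi * x * y)) \<in> borel_measurable (fb_measure \<alpha>)"
    by (intro borel_measurable_times borel_measurable_integrable[OF assms(2)])
  show "AE x in fb_measure \<alpha>. norm (g x * bessel_j \<alpha> (2 * pi * x * y)) \<le> norm (g x)"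
    using abs_bessel_j_le_1[OF assms(1)] by (auto simp: abs_mult intro!: mult_left_le)
qed

text \<open>
  Integrate the Bessel series term by term: by \<open>gaussian_moment\<close> the result is the exponential series.
  The integrals of the absolute values sum to another exponential series, which justifies the exchange.
\<close>

lemma hankel_gaussian:
  assumes "\<alpha> \<ge> 0" "t > 0"
  shows "hankel \<alpha> (\<lambda>x. exp (- (pi * t * x\<^sup>2))) y = t powr - (\<alpha> + 1) * exp (- (pi * (1 / t) * y\<^sup>2))"
proof -
  let ?c = "bessel_coeff \<alpha>" and ?K = "t powr - (\<alpha> + 1)"
  define F where "F = (\<lambda>n x. ?c n * (pi * y) ^ (2 * n) * (x ^ (2 * n) * exp (- (pi * t * x\<^sup>2))))"
  have mom: "pochhammer (\<alpha> + 1) n / (pi * t) ^ n * (pi * y) ^ (2 * n) / (fact n * pochhammer (\<alpha> + 1) n)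
      = (pi * y\<^sup>2 / t) ^ n / fact n" for n
  proof -
    have "pochhammer (\<alpha> + 1) n > 0"
      using pochhammer_ge_1[OF assms(1), of n] by simp
    then show ?thesis
      using assms(2) by (simp add: power_mult_distrib power_divide power_mult power2_eq_square)
  qed
  have hF: "has_bochner_integral (fb_measure \<alpha>) (F n)
      (?c n * (pi * y) ^ (2 * n) * (pochhammer (\<alpha> + 1) n / (pi * t) ^ n * ?K))" for n
    unfolding F_def by (intro has_bochner_integral_mult_right gaussian_moment assms)
  have iF: "integral\<^sup>L (fb_measure \<alpha>) (F n) = (- (pi * y\<^sup>2 / t)) ^ n / fact n * ?K" for n
  proof -
    have "integral\<^sup>L (fb_measure \<alpha>) (F n)
        = ?c n * (pi * y) ^ (2 * n) * (pochhammer (\<alpha> + 1) n / (pi * t) ^ n * ?K)"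
      using hF by (rule has_bochner_integral_integral_eq)
    also have "\<dots> = (-1) ^ n * (pochhammer (\<alpha> + 1) n / (pi * t) ^ n * (pi * y) ^ (2 * n)
        / (fact n * pochhammer (\<alpha> + 1) n)) * ?K"
      by (simp add: bessel_coeff_def mult_ac)
    also have "\<dots> = (-1) ^ n * ((pi * y\<^sup>2 / t) ^ n / fact n) * ?K"
      unfolding mom ..
    also have "\<dots> = (- (pi * y\<^sup>2 / t)) ^ n / fact n * ?K"
      by (simp add: power_minus[of "pi * y\<^sup>2 / t"])
    finally show ?thesis .
  qed
  have nF: "(LINT x|fb_measure \<alpha>. norm (F n x)) = inverse (fact n) * (pi * y\<^sup>2 / t) ^ n * ?K" for n
  proof -
    have "norm (F n x) = (-1) ^ n * F n x" for x
    proof -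
      have "pochhammer (\<alpha> + 1) n > 0"
        using pochhammer_ge_1[OF assms(1), of n] by simp
      then have "\<bar>?c n\<bar> = (-1) ^ n * ?c n"
        by (simp add: bessel_coeff_def abs_mult)
      then show ?thesis
        by (simp add: F_def abs_mult power_mult)
    qed
    then have "(LINT x|fb_measure \<alpha>. norm (F n x)) = (-1) ^ n * ((- (pi * y\<^sup>2 / t)) ^ n / fact n * ?K)"
      using iF[of n] by simp
    also have "(-1) ^ n * ((- (pi * y\<^sup>2 / t)) ^ n / fact n * ?K)
        = ((-1) * (- (pi * y\<^sup>2 / t))) ^ n / fact n * ?K"
      by (simp only: power_mult_distrib) simp
    finally show ?thesis
      by (simp add: inverse_eq_divide)
  qed
  have Fsum: "(\<lambda>n. F n x) sums (exp (- (pi * t * x\<^sup>2)) * bessel_j \<alpha> (2 * pi * x * y))" for x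
  proof -
    have "(\<lambda>n. exp (- (pi * t * x\<^sup>2)) * (?c n * ((2 * pi * x * y)\<^sup>2 / 4) ^ n))
        sums (exp (- (pi * t * x\<^sup>2)) * bessel_series \<alpha> ((2 * pi * x * y)\<^sup>2 / 4))"
      unfolding bessel_series_def by (intro sums_mult summable_sums summable_bessel assms)
    moreover have "exp (- (pi * t * x\<^sup>2)) * (?c n * ((2 * pi * x * y)\<^sup>2 / 4) ^ n) = F n x" for n
    proof -
      have "((2 * pi * x * y)\<^sup>2 / 4) ^ n = (pi * y) ^ (2 * n) * x ^ (2 * n)"
        by (simp add: power_mult power_mult_distrib)
      then show ?thesis
        by (simp add: F_def)
    qed
    ultimately show ?thesis
      by (simp add: bessel_j_eq_series[OF assms(1)])
  qed
  have "hankel \<alpha> (\<lambda>x. exp (- (pi * t * x\<^sup>2))) y = (LINT x|fb_measure \<alpha>. (\<Sum>n. F n x))"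
    unfolding hankel_def using Fsum by (simp add: sums_iff)
  also have "\<dots> = (\<Sum>n. integral\<^sup>L (fb_measure \<alpha>) (F n))"
  proof (rule integral_suminf)
    show "integrable (fb_measure \<alpha>) (F n)" for n
      using hF has_bochner_integral_iff by blast
    show "AE x in fb_measure \<alpha>. summable (\<lambda>n. norm (F n x))"
    proof (rule AE_I2)
      fix x
      let ?z = "(pi * y * x)\<^sup>2"
      have "summable (\<lambda>n. exp (- (pi * t * x\<^sup>2)) * (inverse (fact n) * ?z ^ n))"
        by (intro summable_mult summable_exp)
      then show "summable (\<lambda>n. norm (F n x))"
      proof (rule summable_comparison_test'[where N = 0])
        fix n
        have "norm (norm (F n x)) = \<bar>?c n\<bar> * (exp (- (pi * t * x\<^sup>2)) * ?z ^ n)"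
          by (simp add: F_def abs_mult power_mult power_mult_distrib)
        also have "\<dots> \<le> 1 / fact n * (exp (- (pi * t * x\<^sup>2)) * ?z ^ n)"
          by (intro mult_right_mono abs_bessel_coeff_le assms) auto
        finally show "norm (norm (F n x)) \<le> exp (- (pi * t * x\<^sup>2)) * (inverse (fact n) * ?z ^ n)"
          by (simp add: inverse_eq_divide)
      qed
    qed
    show "summable (\<lambda>n. LINT x|fb_measure \<alpha>. norm (F n x))"
      unfolding nF by (intro summable_mult2 summable_exp)
  qed
  also have "\<dots> = ?K * exp (- (pi * (1 / t) * y\<^sup>2))"
  proof -
    have "(\<lambda>n. ((- (pi * y\<^sup>2 / t)) ^ n /\<^sub>R fact n) * ?K) sums (exp (- (pi * y\<^sup>2 / t)) * ?K)"
      by (intro sums_mult2 exp_converges)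
    then show ?thesis
      unfolding iF by (simp add: sums_iff inverse_eq_divide mult.commute)
  qed
  finally show ?thesis .
qed

section \<open>Parseval's identity for sums of Gaussians\<close>

definition gauss_sum :: "(nat \<Rightarrow> real) \<Rightarrow> (nat \<Rightarrow> real) \<Rightarrow> nat \<Rightarrow> real \<Rightarrow> real" where
  "gauss_sum a t d x = (\<Sum>k\<le>d. a k * exp (- (pi * t k * x\<^sup>2)))"

lemma borel_measurable_gauss_sum [measurable]: "gauss_sum a t d \<in> borel_measurable borel"
  unfolding gauss_sum_def[abs_def] by measurable

lemma integrable_gauss_sum:
  assumes "\<alpha> \<ge> 0" "\<And>k. t k > 0"
  shows "integrable (fb_measure \<alpha>) (gauss_sum a t d)"
  unfolding gauss_sum_def[abs_def]
  using gaussian_integral[OF assms(1) assms(2)]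
  by (intro Bochner_Integration.integrable_sum integrable_mult_right) (auto simp: has_bochner_integral_iff)

lemma hankel_gauss_sum:
  assumes "\<alpha> \<ge> 0" "\<And>k. t k > 0"
  shows "hankel \<alpha> (gauss_sum a t d) = gauss_sum (\<lambda>k. a k * t k powr - (\<alpha> + 1)) (\<lambda>k. 1 / t k) d"
proof
  fix y
  let ?e = "\<lambda>k x. exp (- (pi * t k * x\<^sup>2))"
  have int: "integrable (fb_measure \<alpha>) (\<lambda>x. a k * (?e k x * bessel_j \<alpha> (2 * pi * x * y)))" for k
    using gaussian_integral[OF assms(1) assms(2), of k]
    by (intro integrable_mult_right integrable_mult_bessel_j assms) (auto simp: has_bochner_integral_iff)
  have "hankel \<alpha> (gauss_sum a t d) y
      = (LINT x|fb_measure \<alpha>. (\<Sum>k\<le>d. a k * (?e k x * bessel_j \<alpha> (2 * pi * x * y))))"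
    by (simp add: hankel_def gauss_sum_def sum_distrib_right mult.assoc)
  also have "\<dots> = (\<Sum>k\<le>d. LINT x|fb_measure \<alpha>. a k * (?e k x * bessel_j \<alpha> (2 * pi * x * y)))"
    by (rule Bochner_Integration.integral_sum) (rule int)
  also have "\<dots> = (\<Sum>k\<le>d. a k * hankel \<alpha> (?e k) y)"
    by (simp add: hankel_def)
  also have "\<dots> = gauss_sum (\<lambda>k. a k * t k powr - (\<alpha> + 1)) (\<lambda>k. 1 / t k) d y"
    by (simp only: hankel_gaussian[OF assms(1) assms(2)] gauss_sum_def) (simp only: mult.assoc)
  finally show "hankel \<alpha> (gauss_sum a t d) y = \<dots>" .
qed

text \<open>
  Inversion, as \<open>t \<mapsto> 1/t\<close> is an involution.
\<close>

lemma hankel_hankel_gauss_sum: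
  assumes "\<alpha> \<ge> 0" "\<And>k. t k > 0"
  shows "hankel \<alpha> (hankel \<alpha> (gauss_sum a t d)) = gauss_sum a t d"
proof -
  have *: "a k * t k powr - (\<alpha> + 1) * (1 / t k) powr - (\<alpha> + 1) = a k" for k
    using assms(2)[of k] by (simp add: powr_mult[symmetric] mult.assoc)
  have "1 / t k > 0" for k
    using assms(2) by simp
  note pos = this
  show ?thesis
    unfolding hankel_gauss_sum[OF assms] hankel_gauss_sum[OF assms(1) pos] * by simp
qed

lemma gauss_sum_inner:
  assumes "\<alpha> \<ge> 0" "\<And>k. t k > 0" "\<And>k. s k > 0"
  shows "has_bochner_integral (fb_measure \<alpha>) (\<lambda>x. gauss_sum a t m x * gauss_sum b s n x)
     (\<Sum>i\<le>m. \<Sum>j\<le>n. a i * b j * (t i + s j) powr - (\<alpha> + 1))"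
proof -
  have "has_bochner_integral (fb_measure \<alpha>)
      (\<lambda>x. \<Sum>i\<le>m. \<Sum>j\<le>n. a i * b j * exp (- (pi * (t i + s j) * x\<^sup>2)))
      (\<Sum>i\<le>m. \<Sum>j\<le>n. a i * b j * (t i + s j) powr - (\<alpha> + 1))"
    using assms(2,3)
    by (intro has_bochner_integral_sum has_bochner_integral_mult_right gaussian_integral assms(1) add_pos_pos)
  also have "(\<lambda>x. \<Sum>i\<le>m. \<Sum>j\<le>n. a i * b j * exp (- (pi * (t i + s j) * x\<^sup>2)))
      = (\<lambda>x. gauss_sum a t m x * gauss_sum b s n x)"
    by (simp add: gauss_sum_def sum_product algebra_simps flip: exp_add)
  finally show ?thesis .
qed

text \<open>
  Both sides are explicit double sums, and they agree because \<open>t s (1/t + 1/s) = t + s\<close>.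
\<close>

lemma gauss_sum_parseval:
  assumes "\<alpha> \<ge> 0" "\<And>k. t k > 0" "\<And>k. s k > 0"
  shows "(LINT x|fb_measure \<alpha>. hankel \<alpha> (gauss_sum a t m) x * hankel \<alpha> (gauss_sum b s n) x)
     = (LINT x|fb_measure \<alpha>. gauss_sum a t m x * gauss_sum b s n x)"
proof -
  have *: "t i powr - (\<alpha> + 1) * s j powr - (\<alpha> + 1) * (1 / t i + 1 / s j) powr - (\<alpha> + 1)
      = (t i + s j) powr - (\<alpha> + 1)" for i j
  proof -
    have "t i * s j * (1 / t i + 1 / s j) = t i + s j"
      using assms(2)[of i] assms(3)[of j] by (simp add: field_simps)
    then show ?thesis
      by (simp only: powr_mult[symmetric])
  qed
  have "(LINT x|fb_measure \<alpha>. hankel \<alpha> (gauss_sum a t m) x * hankel \<alpha> (gauss_sum b s n) x)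
      = (\<Sum>i\<le>m. \<Sum>j\<le>n. a i * t i powr - (\<alpha> + 1) * (b j * s j powr - (\<alpha> + 1))
          * (1 / t i + 1 / s j) powr - (\<alpha> + 1))"
    using assms by (simp add: hankel_gauss_sum has_bochner_integral_integral_eq[OF gauss_sum_inner])
  also have "\<dots> = (\<Sum>i\<le>m. \<Sum>j\<le>n. a i * b j * (t i + s j) powr - (\<alpha> + 1))"
    unfolding *[symmetric] by (simp add: mult_ac)
  also have "\<dots> = (LINT x|fb_measure \<alpha>. gauss_sum a t m x * gauss_sum b s n x)"
    using assms by (simp add: has_bochner_integral_integral_eq[OF gauss_sum_inner])
  finally show ?thesis .
qed

text \<open>
  With \<open>u = exp (- \<pi> x\<^sup>2)\<close>, a combination of \<open>exp (- k \<pi> x\<^sup>2)\<close>, \<open>k \<ge> 1\<close>, is \<open>u P(u)\<close> for a polynomial \<open>P\<close>.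
  Weierstrass' theorem applies to \<open>g/u\<close>, which is continuous in \<open>u \<in> [0, 1]\<close> because \<open>g\<close> vanishes
  for small \<open>u\<close>. Multiplying back by \<open>u\<close> gives an error that is small relative to a Gaussian, hence
  small in \<open>L\<^sup>1\<close> and \<open>L\<^sup>2\<close> at once.
\<close>

lemma gauss_sum_approx:
  fixes g :: "real \<Rightarrow> real"
  assumes "continuous_on UNIV g" "\<And>x. x \<ge> R \<Longrightarrow> g x = 0" "R > 0" "\<epsilon> > 0"
  obtains a d where
    "\<And>x. x \<ge> 0 \<Longrightarrow> \<bar>g x - gauss_sum a (\<lambda>k. real (Suc k)) d x\<bar> \<le> \<epsilon> * exp (- (pi * x\<^sup>2))"
proof -
  define \<delta> where "\<delta> = exp (- (pi * R\<^sup>2))"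
  have \<delta>: "\<delta> > 0" "\<delta> \<le> 1" by (auto simp: \<delta>_def)
  \<comment> \<open>Cutting \<open>u\<close> off at \<open>\<delta>\<close> replaces all \<open>x > R\<close> by \<open>R\<close>, where \<open>g\<close> is zero as well.\<close>
  define G where "G = (\<lambda>u. g (sqrt (- (ln (max u \<delta>)) / pi)) / max u \<delta>)"
  have "continuous_on {0..1} (\<lambda>u. g (sqrt (- (ln (max u \<delta>)) / pi)))"
    by (rule continuous_on_compose2[OF assms(1)], intro continuous_intros) (use \<delta> in \<open>auto simp: max_def\<close>)
  then have "continuous_on {0..1} G"
    unfolding G_def using \<delta> by (intro continuous_intros) (auto simp: max_def)
  then obtain P where P: "real_polynomial_function P" "\<And>u. u \<in> {0..1} \<Longrightarrow> \<bar>G u - P u\<bar> < \<epsilon>"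
    using Stone_Weierstrass_real_polynomial_function[of "{0..1}" G \<epsilon>] assms(4) by auto
  then obtain a d where ad: "P = (\<lambda>u. \<Sum>k\<le>d. a k * u ^ k)"
    unfolding real_polynomial_function_iff_sum by blast
  have "\<bar>g x - gauss_sum a (\<lambda>k. real (Suc k)) d x\<bar> \<le> \<epsilon> * exp (- (pi * x\<^sup>2))" if "x \<ge> 0" for x
  proof -
    let ?u = "exp (- (pi * x\<^sup>2))"
    have "gauss_sum a (\<lambda>k. real (Suc k)) d x = ?u * P ?u"
      unfolding ad gauss_sum_def sum_distrib_left
      by (intro sum.cong refl) (simp add: algebra_simps flip: exp_of_nat_mult exp_add)
    moreover have "g x = ?u * G ?u"
    proof (cases "x \<le> R")
      case True
      then have "x\<^sup>2 \<le> R\<^sup>2"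
        using that by (intro power_mono) auto
      then have "max ?u \<delta> = ?u"
        by (simp add: \<delta>_def)
      then show ?thesis
        using that by (simp add: G_def)
    next
      case False
      then have "R\<^sup>2 \<le> x\<^sup>2"
        using assms(3) by (intro power_mono) auto
      then have "max ?u \<delta> = \<delta>"
        by (simp add: \<delta>_def)
      moreover have "sqrt (- ln \<delta> / pi) = R"
        using assms(3) by (simp add: \<delta>_def)
      ultimately show ?thesis
        using False assms(2)[of x] assms(2)[of R] by (simp add: G_def)
    qed
    ultimately have "\<bar>g x - gauss_sum a (\<lambda>k. real (Suc k)) d x\<bar> = ?u * \<bar>G ?u - P ?u\<bar>"
      by (simp add: abs_mult flip: right_diff_distrib)
    also have "\<dots> \<le> ?u * \<epsilon>"
      using P(2)[of ?u] by (intro mult_left_mono) auto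
    finally show ?thesis by (simp add: mult.commute)
  qed
  then show thesis by (rule that)
qed

text \<open>
  Fatou's lemma for nonnegative real functions.
\<close>

lemma integral_le_of_tendsto:
  fixes u :: "nat \<Rightarrow> 'a \<Rightarrow> real"
  assumes "\<And>m. integrable M (u m)" "\<And>m x. u m x \<ge> 0" "\<And>m. integral\<^sup>L M (u m) \<le> K"
    and "v \<in> borel_measurable M" "\<And>x. (\<lambda>m. u m x) \<longlonglongrightarrow> v x"
  shows "integrable M v" "integral\<^sup>L M v \<le> K"
proof -
  have v: "v x \<ge> 0" for x
    by (rule LIMSEQ_le_const[OF assms(5)]) (auto simp: assms(2))
  have K: "K \<ge> 0"
    by (rule order_trans[OF Bochner_Integration.integral_nonneg assms(3)[of 0]]) (rule assms(2))
  have "(\<integral>\<^sup>+x. ennreal (v x) \<partial>M) = (\<integral>\<^sup>+x. liminf (\<lambda>m. ennreal (u m x)) \<partial>M)"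
    using assms(5) by (intro nn_integral_cong lim_imp_Liminf[symmetric] tendsto_ennrealI) auto
  also have "\<dots> \<le> liminf (\<lambda>m. \<integral>\<^sup>+x. ennreal (u m x) \<partial>M)"
    using assms(1) by (intro nn_integral_liminf) (auto dest: borel_measurable_integrable)
  also have "\<dots> \<le> liminf (\<lambda>m::nat. ennreal K)"
  proof (rule Liminf_mono, rule always_eventually, rule allI)
    fix m show "(\<integral>\<^sup>+x. ennreal (u m x) \<partial>M) \<le> ennreal K"
      using assms(1-3)[of m] by (subst nn_integral_eq_integral) (auto intro: ennreal_leI)
  qed
  also have "\<dots> = ennreal K"
    by (simp add: Liminf_const)
  finally have *: "(\<integral>\<^sup>+x. ennreal (v x) \<partial>M) \<le> ennreal K" .
  then show "integrable M v"
    using assms(4) v by (intro integrableI_nonneg) (auto simp: le_less_trans[OF _ ennreal_less_top])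
  then show "integral\<^sup>L M v \<le> K"
    using * v K by (simp add: nn_integral_eq_integral)
qed

lemma integrable_square_diff:
  fixes u v :: "'a \<Rightarrow> real"
  assumes "u \<in> borel_measurable M" "v \<in> borel_measurable M"
    and "integrable M (\<lambda>x. (u x)\<^sup>2)" "integrable M (\<lambda>x. (v x)\<^sup>2)"
  shows "integrable M (\<lambda>x. (u x - v x)\<^sup>2)"
proof (rule Bochner_Integration.integrable_bound)
  show "integrable M (\<lambda>x. 2 * (u x)\<^sup>2 + 2 * (v x)\<^sup>2)"
    using assms by (intro Bochner_Integration.integrable_add integrable_mult_right)
  show "(\<lambda>x. (u x - v x)\<^sup>2) \<in> borel_measurable M"
    using assms by measurable
  have "(u x - v x)\<^sup>2 \<le> 2 * (u x)\<^sup>2 + 2 * (v x)\<^sup>2" for x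
    using zero_le_power2[of "u x + v x"] by (simp add: power2_eq_square algebra_simps)
  then show "AE x in M. norm ((u x - v x)\<^sup>2) \<le> norm (2 * (u x)\<^sup>2 + 2 * (v x)\<^sup>2)"
    by simp
qed

text \<open>
  Norms converge along a sequence that converges in \<open>L\<^sup>2\<close>. Bounding the mixed term by
  \<open>2\<bar>w v\<bar> \<le> w\<^sup>2/\<delta> + \<delta> v\<^sup>2\<close> with \<open>\<delta>\<close> the rate of convergence replaces the Cauchy-Schwarz inequality.
\<close>

lemma integral_square_tendsto:
  fixes u :: "nat \<Rightarrow> 'a \<Rightarrow> real"
  assumes "\<And>n. u n \<in> borel_measurable M" "v \<in> borel_measurable M"
    and "\<And>n. integrable M (\<lambda>x. (u n x)\<^sup>2)" "integrable M (\<lambda>x. (v x)\<^sup>2)"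
    and "\<And>n. (LINT x|M. (u n x - v x)\<^sup>2) \<le> (\<delta> n)\<^sup>2" "\<And>n. \<delta> n > 0" "\<delta> \<longlonglongrightarrow> 0"
  shows "(\<lambda>n. LINT x|M. (u n x)\<^sup>2) \<longlonglongrightarrow> (LINT x|M. (v x)\<^sup>2)"
proof -
  let ?V = "LINT x|M. (v x)\<^sup>2"
  have bound: "norm ((LINT x|M. (u n x)\<^sup>2) - ?V) \<le> (\<delta> n)\<^sup>2 + \<delta> n + \<delta> n * ?V" for n
  proof -
    let ?w = "\<lambda>x. u n x - v x"
    have iw: "integrable M (\<lambda>x. (?w x)\<^sup>2)"
      using assms by (intro integrable_square_diff)
    have "\<bar>(LINT x|M. (u n x)\<^sup>2) - ?V\<bar> = \<bar>LINT x|M. (u n x)\<^sup>2 - (v x)\<^sup>2\<bar>"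
      using assms by simp
    also have "\<dots> \<le> (LINT x|M. \<bar>(u n x)\<^sup>2 - (v x)\<^sup>2\<bar>)"
      using integral_norm_bound[of M "\<lambda>x. (u n x)\<^sup>2 - (v x)\<^sup>2"] by simp
    also have "\<dots> \<le> (LINT x|M. (1 + 1 / \<delta> n) * (?w x)\<^sup>2 + \<delta> n * (v x)\<^sup>2)"
    proof (rule integral_mono)
      show "integrable M (\<lambda>x. \<bar>(u n x)\<^sup>2 - (v x)\<^sup>2\<bar>)"
        using assms by (intro integrable_abs Bochner_Integration.integrable_diff)
      show "integrable M (\<lambda>x. (1 + 1 / \<delta> n) * (?w x)\<^sup>2 + \<delta> n * (v x)\<^sup>2)"
        using assms iw by (intro Bochner_Integration.integrable_add integrable_mult_right)
      fix x
      have "\<delta> n > 0" by (rule assms)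
      have y: "\<bar>2 * w * b\<bar> \<le> w\<^sup>2 / d + d * b\<^sup>2" if "d > 0" for w b d :: real
      proof -
        have "2 * \<bar>w\<bar> * (d * \<bar>b\<bar>) \<le> \<bar>w\<bar>\<^sup>2 + (d * \<bar>b\<bar>)\<^sup>2"
          by (rule sum_squares_bound)
        then have "2 * \<bar>w\<bar> * (d * \<bar>b\<bar>) / d \<le> (\<bar>w\<bar>\<^sup>2 + (d * \<bar>b\<bar>)\<^sup>2) / d"
          using that by (intro divide_right_mono) auto
        also have "(\<bar>w\<bar>\<^sup>2 + (d * \<bar>b\<bar>)\<^sup>2) / d = w\<^sup>2 / d + d * b\<^sup>2"
          using that by (simp add: power_mult_distrib add_divide_distrib) (simp add: power2_eq_square)
        finally show ?thesis
          using that by (simp add: abs_mult)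
      qed
      have "(u n x)\<^sup>2 - (v x)\<^sup>2 = (?w x)\<^sup>2 + 2 * ?w x * v x"
        by (simp add: power2_eq_square algebra_simps)
      then have "\<bar>(u n x)\<^sup>2 - (v x)\<^sup>2\<bar> \<le> (?w x)\<^sup>2 + \<bar>2 * ?w x * v x\<bar>"
        by (metis abs_triangle_ineq abs_power2)
      also have "\<dots> \<le> (?w x)\<^sup>2 + ((?w x)\<^sup>2 / \<delta> n + \<delta> n * (v x)\<^sup>2)"
        using y[OF \<open>\<delta> n > 0\<close>] by (intro add_left_mono)
      finally show "\<bar>(u n x)\<^sup>2 - (v x)\<^sup>2\<bar> \<le> (1 + 1 / \<delta> n) * (?w x)\<^sup>2 + \<delta> n * (v x)\<^sup>2"
        by (simp add: algebra_simps)
    qed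
    also have "\<dots> = (1 + 1 / \<delta> n) * (LINT x|M. (?w x)\<^sup>2) + \<delta> n * ?V"
      using iw assms by simp
    also have "\<dots> \<le> (1 + 1 / \<delta> n) * (\<delta> n)\<^sup>2 + \<delta> n * ?V"
      using assms(5,6)[of n] by (intro add_right_mono mult_left_mono) auto
    also have "\<dots> = (\<delta> n)\<^sup>2 + \<delta> n + \<delta> n * ?V"
      using assms(6)[of n] by (simp add: power2_eq_square field_simps)
    finally show ?thesis by simp
  qed
  have "(\<lambda>n. (\<delta> n)\<^sup>2 + \<delta> n + \<delta> n * ?V) \<longlonglongrightarrow> 0\<^sup>2 + 0 + 0 * ?V"
    by (intro tendsto_intros assms(7))
  then have lim: "(\<lambda>n. (\<delta> n)\<^sup>2 + \<delta> n + \<delta> n * ?V) \<longlonglongrightarrow> 0"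
    by simp
  have "(\<lambda>n. (LINT x|M. (u n x)\<^sup>2) - ?V) \<longlonglongrightarrow> 0"
    by (rule Lim_null_comparison[OF always_eventually[OF allI] lim]) (rule bound)
  then show ?thesis
    by (simp only: LIM_zero_iff)
qed

lemma of_real_in_fb_L2:
  fixes u :: "real \<Rightarrow> real"
  assumes "u \<in> borel_measurable borel" "integrable (fb_measure \<alpha>) (\<lambda>x. (u x)\<^sup>2)"
  shows "(\<lambda>x. complex_of_real (u x)) \<in> fb_Lp \<alpha> 2"
  using assms borel_measurable_fb_measure[OF assms(1), of \<alpha>] by (simp add: fb_Lp_def)

lemma fb_converges_of_real:
  fixes u :: "nat \<Rightarrow> real \<Rightarrow> real"
  assumes "\<And>n. u n \<in> borel_measurable borel" "v \<in> borel_measurable borel"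
    and "\<And>n. integrable (fb_measure \<alpha>) (\<lambda>x. (u n x)\<^sup>2)" "integrable (fb_measure \<alpha>) (\<lambda>x. (v x)\<^sup>2)"
    and "\<And>n. (LINT x|fb_measure \<alpha>. (u n x - v x)\<^sup>2) \<le> (\<delta> n)\<^sup>2" "\<And>n. \<delta> n > 0" "\<delta> \<longlonglongrightarrow> 0"
  shows "fb_converges \<alpha> 2 (\<lambda>n x. complex_of_real (u n x)) (\<lambda>x. complex_of_real (v x))"
proof -
  have "fb_norm \<alpha> 2 (\<lambda>x. complex_of_real (u n x) - complex_of_real (v x))
      = sqrt (LINT x|fb_measure \<alpha>. (u n x - v x)\<^sup>2)" for n
    by (simp add: fb_norm_def powr_half_sqrt flip: of_real_diff)
  moreover have "sqrt (LINT x|fb_measure \<alpha>. (u n x - v x)\<^sup>2) \<le> \<delta> n" for n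
    using assms(5,6)[of n] by (intro real_le_lsqrt) auto
  ultimately have "(\<lambda>n. fb_norm \<alpha> 2 (\<lambda>x. complex_of_real (u n x) - complex_of_real (v x))) \<longlonglongrightarrow> 0"
    by (intro Lim_null_comparison[OF _ assms(7)]) auto
  then show ?thesis
    using assms by (simp add: fb_converges_def of_real_in_fb_L2)
qed

section \<open>Plancherel's theorem for continuous functions of bounded support\<close>

text \<open>
  Let \<open>p\<^sub>n\<close> be Gaussian sums tending to \<open>g\<close> in \<open>L\<^sup>1\<close> and \<open>L\<^sup>2\<close>, and \<open>q\<^sub>n\<close> their transforms. Convergence
  in \<open>L\<^sup>1\<close> and \<open>\<bar>j\<^sub>\<alpha>\<bar> \<le> 1\<close> give \<open>q\<^sub>n \<rightarrow> hankel g\<close> pointwise. Parseval's identity shows that \<open>q\<^sub>n\<close> is a Cauchy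
  sequence in \<open>L\<^sup>2\<close>, and Fatou's lemma identifies its limit as \<open>hankel g\<close>, so
  the equality of norms passes to the limit. As the transform of \<open>q\<^sub>n\<close> is
  \<open>p\<^sub>n\<close>, the sequence \<open>q\<^sub>n\<close> exhibits \<open>g\<close> as the transform of \<open>hankel g\<close> in \<open>L\<^sup>2\<close>.
\<close>

theorem hankel_plancherel:
  fixes g :: "real \<Rightarrow> real"
  assumes "\<alpha> \<ge> 0" "continuous_on UNIV g" "\<And>x. x \<ge> R \<Longrightarrow> g x = 0" "R > 0"
  shows "hankel \<alpha> g \<in> borel_measurable borel"
    and "integrable (fb_measure \<alpha>) g"
    and "integrable (fb_measure \<alpha>) (\<lambda>x. (hankel \<alpha> g x)\<^sup>2)"
    and "(LINT x|fb_measure \<alpha>. (hankel \<alpha> g x)\<^sup>2) = (LINT x|fb_measure \<alpha>. (g x)\<^sup>2)"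
    and "has_fourier_bessel_L2 \<alpha> (\<lambda>x. complex_of_real (hankel \<alpha> g x)) (\<lambda>x. complex_of_real (g x))"
proof -
  let ?M = "fb_measure \<alpha>" and ?t = "\<lambda>k::nat. real (Suc k)"
  define \<epsilon> where "\<epsilon> = (\<lambda>n. 1 / real (Suc n))"
  have \<epsilon>: "\<epsilon> n > 0" for n by (simp add: \<epsilon>_def)
  have \<epsilon>_dec: "\<epsilon> (n + m) \<le> \<epsilon> n" for n m by (simp add: \<epsilon>_def frac_le)
  have \<epsilon>_lim: "\<epsilon> \<longlonglongrightarrow> 0"
    unfolding \<epsilon>_def using LIMSEQ_inverse_real_of_nat by (simp add: inverse_eq_divide)
  have t: "?t k > 0" for k by simp
  let ?e = "\<lambda>x::real. exp (- (pi * 1 * x\<^sup>2))"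
  have "\<exists>a d. \<forall>x\<ge>0. \<bar>g x - gauss_sum a ?t d x\<bar> \<le> \<epsilon> n * ?e x" for n
    using gauss_sum_approx[OF assms(2,3,4) \<epsilon>, of n] by (metis mult.right_neutral)
  then obtain a d where ad: "\<And>n x. x \<ge> 0 \<Longrightarrow> \<bar>g x - gauss_sum (a n) ?t (d n) x\<bar> \<le> \<epsilon> n * ?e x"
    by metis
  define p where "p = (\<lambda>n. gauss_sum (a n) ?t (d n))"
  define q where "q = (\<lambda>n. hankel \<alpha> (p n))"
  have q_eq: "q n = gauss_sum (\<lambda>k. a n k * ?t k powr - (\<alpha> + 1)) (\<lambda>k. 1 / ?t k) (d n)" for n
    unfolding q_def p_def by (rule hankel_gauss_sum[where t = ?t, OF assms(1) t])
  have app: "\<bar>g x - p n x\<bar> \<le> \<epsilon> n * ?e x" if "x \<ge> 0" for n x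
    unfolding p_def by (rule ad[OF that])
  have p_meas [measurable]: "p n \<in> borel_measurable borel" for n
    unfolding p_def by measurable
  have q_meas [measurable]: "q n \<in> borel_measurable borel" for n
    unfolding q_eq by measurable
  have g_meas [measurable]: "g \<in> borel_measurable borel"
    using assms(2) by (rule borel_measurable_continuous_onI)
  note meas = borel_measurable_fb_measure[OF p_meas] borel_measurable_fb_measure[OF q_meas]
    borel_measurable_fb_measure[OF g_meas]
  have p_int: "integrable ?M (p n)" for n
    unfolding p_def by (rule integrable_gauss_sum[where t = ?t, OF assms(1) t])
  have q_int: "integrable ?M (q n)" for n
    unfolding q_eq by (rule integrable_gauss_sum[OF assms(1)]) simp
  have pp: "integrable ?M (\<lambda>x. p n x * p m x)" for n m
    using gauss_sum_inner[where t = ?t and s = ?t, OF assms(1) t t] unfolding p_def has_bochner_integral_iff by blast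
  have qq: "integrable ?M (\<lambda>x. q n x * q m x)" for n m
    using gauss_sum_inner[OF assms(1), of "\<lambda>k. 1 / ?t k" "\<lambda>k. 1 / ?t k"]
    unfolding q_eq has_bochner_integral_iff by simp
  have p2: "integrable ?M (\<lambda>x. (p n x)\<^sup>2)" and q2: "integrable ?M (\<lambda>x. (q n x)\<^sup>2)" for n
    using pp[of n n] qq[of n n] by (simp_all add: power2_eq_square)
  have parseval: "(LINT x|?M. q n x * q m x) = (LINT x|?M. p n x * p m x)" for n m
    unfolding q_def p_def by (rule gauss_sum_parseval[where t = ?t and s = ?t, OF assms(1) t t])
  have hq: "hankel \<alpha> (q n) = p n" for n
    unfolding q_def p_def by (rule hankel_hankel_gauss_sum[where t = ?t, OF assms(1) t])
  have e: "has_bochner_integral ?M ?e 1"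
    using gaussian_integral[OF assms(1), of 1] by simp
  have e_int: "integrable ?M ?e" and e1: "integral\<^sup>L ?M ?e = 1"
    using e by (simp_all only: has_bochner_integral_iff)
  have e2_int: "integrable ?M (\<lambda>x. (?e x)\<^sup>2)"
    and e2: "(LINT x|?M. (?e x)\<^sup>2) \<le> 1"
  proof -
    have sq: "(?e x)\<^sup>2 \<le> ?e x" for x
      by (simp add: power2_eq_square mult_left_le)
    show *: "integrable ?M (\<lambda>x. (?e x)\<^sup>2)"
    proof (rule Bochner_Integration.integrable_bound[OF e_int])
      show "(\<lambda>x. (?e x)\<^sup>2) \<in> borel_measurable ?M"
        by (rule borel_measurable_fb_measure) measurable
    qed (use sq in auto)
    show "(LINT x|?M. (?e x)\<^sup>2) \<le> 1"
      using integral_mono[OF * e_int sq] e1 by linarith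
  qed
  \<comment> \<open>Everything dominated by \<open>\<eta>\<close> times the standard Gaussian has both norms at most \<open>\<eta>\<close>.\<close>
  have close: "integrable ?M w" "integral\<^sup>L ?M (\<lambda>x. \<bar>w x\<bar>) \<le> \<eta>"
      "integrable ?M (\<lambda>x. (w x)\<^sup>2)" "(LINT x|?M. (w x)\<^sup>2) \<le> \<eta>\<^sup>2"
    if w: "w \<in> borel_measurable ?M" "\<And>x. x \<ge> 0 \<Longrightarrow> \<bar>w x\<bar> \<le> \<eta> * ?e x" for w \<eta>
  proof -
    have sq: "(w x)\<^sup>2 \<le> \<eta>\<^sup>2 * (?e x)\<^sup>2" if "x \<ge> 0" for x
      using power_mono[OF w(2)[OF that], of 2] by (simp only: power_mult_distrib power2_abs abs_ge_zero)
    have ie: "integrable ?M (\<lambda>x. \<eta> * ?e x)" "integrable ?M (\<lambda>x. \<eta>\<^sup>2 * (?e x)\<^sup>2)"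
      by (rule integrable_mult_right[OF e_int] integrable_mult_right[OF e2_int])+
    show iw: "integrable ?M w"
    proof (rule Bochner_Integration.integrable_bound[OF ie(1) w(1)], rule AE_I2)
      show "norm (w x) \<le> norm (\<eta> * ?e x)" if "x \<in> space ?M" for x
        using w(2)[of x] that by simp
    qed
    show iw2: "integrable ?M (\<lambda>x. (w x)\<^sup>2)"
    proof (rule Bochner_Integration.integrable_bound[OF ie(2)])
      show "(\<lambda>x. (w x)\<^sup>2) \<in> borel_measurable ?M" using w(1) by measurable
    qed (use sq in auto)
    have "integral\<^sup>L ?M (\<lambda>x. \<bar>w x\<bar>) \<le> (LINT x|?M. \<eta> * ?e x)"
      using iw ie w(2) by (intro integral_mono) auto
    then show "integral\<^sup>L ?M (\<lambda>x. \<bar>w x\<bar>) \<le> \<eta>"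
      using e1 by simp
    have "(LINT x|?M. (w x)\<^sup>2) \<le> (LINT x|?M. \<eta>\<^sup>2 * (?e x)\<^sup>2)"
      using iw2 ie sq by (intro integral_mono) auto
    also have "\<dots> = \<eta>\<^sup>2 * (LINT x|?M. (?e x)\<^sup>2)"
      by (rule integral_mult_right_zero)
    also have "\<dots> \<le> \<eta>\<^sup>2"
      using mult_left_mono[OF e2, of "\<eta>\<^sup>2"] by simp
    finally show "(LINT x|?M. (w x)\<^sup>2) \<le> \<eta>\<^sup>2" .
  qed
  have gp: "integrable ?M (\<lambda>x. g x - p n x)" "integral\<^sup>L ?M (\<lambda>x. \<bar>g x - p n x\<bar>) \<le> \<epsilon> n"
      "integrable ?M (\<lambda>x. (g x - p n x)\<^sup>2)" "(LINT x|?M. (g x - p n x)\<^sup>2) \<le> (\<epsilon> n)\<^sup>2" for n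
    using close[of "\<lambda>x. g x - p n x" "\<epsilon> n"] app meas by auto
  show g_int: "integrable ?M g"
    using Bochner_Integration.integrable_add[OF gp(1) p_int, of 0 0] by simp
  have g2: "integrable ?M (\<lambda>x. (g x)\<^sup>2)"
    using integrable_square_diff[of "\<lambda>x. g x - p 0 x" ?M "\<lambda>x. - p 0 x"] gp(3)[of 0] p2[of 0] meas
    by simp
  have q_lim: "(\<lambda>n. q n y) \<longlonglongrightarrow> hankel \<alpha> g y" for y
  proof -
    let ?j = "\<lambda>x. bessel_j \<alpha> (2 * pi * x * y)"
    have "norm (q n y - hankel \<alpha> g y) \<le> \<epsilon> n" for n
    proof -
      have "hankel \<alpha> g y - q n y = (LINT x|?M. (g x - p n x) * ?j x)"
        unfolding q_def hankel_def left_diff_distrib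
        by (rule Bochner_Integration.integral_diff[symmetric])
          (rule integrable_mult_bessel_j[OF assms(1)], rule g_int p_int)+
      moreover have "norm (LINT x|?M. (g x - p n x) * ?j x) \<le> (LINT x|?M. \<bar>g x - p n x\<bar>)"
      proof (rule order_trans[OF integral_norm_bound integral_mono])
        show "integrable ?M (\<lambda>x. norm ((g x - p n x) * ?j x))"
          by (rule integrable_norm[OF integrable_mult_bessel_j[OF assms(1) gp(1)]])
        show "integrable ?M (\<lambda>x. \<bar>g x - p n x\<bar>)"
          by (rule integrable_abs[OF gp(1)])
        show "norm ((g x - p n x) * ?j x) \<le> \<bar>g x - p n x\<bar>" for x
          using abs_bessel_j_le_1[OF assms(1)] by (simp add: abs_mult mult_left_le)
      qed
      ultimately show ?thesis
        using gp(2)[of n] by simp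
    qed
    then have "(\<lambda>n. q n y - hankel \<alpha> g y) \<longlonglongrightarrow> 0"
      by (intro Lim_null_comparison[OF always_eventually[OF allI] \<epsilon>_lim])
    then show ?thesis
      by (simp only: LIM_zero_iff)
  qed
  show h_meas: "hankel \<alpha> g \<in> borel_measurable borel"
    by (rule borel_measurable_LIMSEQ_real[OF q_lim q_meas])
  note hm = borel_measurable_fb_measure[OF h_meas]
  have qdiff: "(LINT x|?M. (q n x - q m x)\<^sup>2) = (LINT x|?M. (p n x - p m x)\<^sup>2)" for n m
  proof -
    have *: "(LINT x|?M. (u n x - u m x)\<^sup>2)
        = (LINT x|?M. u n x * u n x) - 2 * (LINT x|?M. u n x * u m x) + (LINT x|?M. u m x * u m x)"
      if "\<And>n m. integrable ?M (\<lambda>x. u n x * u m x)" for u :: "nat \<Rightarrow> real \<Rightarrow> real"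
    proof -
      have "(\<lambda>x. (u n x - u m x)\<^sup>2) = (\<lambda>x. u n x * u n x - 2 * (u n x * u m x) + u m x * u m x)"
        by (auto simp: power2_eq_square algebra_simps)
      then show ?thesis
        using that by simp
    qed
    show ?thesis
      using *[of q, OF qq] *[of p, OF pp] by (simp only: parseval)
  qed
  have pdiff: "(LINT x|?M. (p n x - p (n + m) x)\<^sup>2) \<le> (2 * \<epsilon> n)\<^sup>2" for n m
  proof (rule close(4))
    fix x :: real assume "x \<ge> 0"
    have "\<bar>p n x - p (n + m) x\<bar> \<le> \<epsilon> n * ?e x + \<epsilon> (n + m) * ?e x"
      using app[OF \<open>x \<ge> 0\<close>, of n] app[OF \<open>x \<ge> 0\<close>, of "n + m"] by linarith
    also have "\<dots> \<le> \<epsilon> n * ?e x + \<epsilon> n * ?e x"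
      by (intro add_left_mono mult_right_mono \<epsilon>_dec) simp
    finally show "\<bar>p n x - p (n + m) x\<bar> \<le> 2 * \<epsilon> n * ?e x" by simp
  qed (use meas in measurable)
  have qh: "integrable ?M (\<lambda>x. (q n x - hankel \<alpha> g x)\<^sup>2)"
    "(LINT x|?M. (q n x - hankel \<alpha> g x)\<^sup>2) \<le> (2 * \<epsilon> n)\<^sup>2" for n
  proof -
    have 1: "integrable ?M (\<lambda>x. (q n x - q (n + m) x)\<^sup>2)" for m
      by (intro integrable_square_diff meas q2)
    have 2: "(LINT x|?M. (q n x - q (n + m) x)\<^sup>2) \<le> (2 * \<epsilon> n)\<^sup>2" for m
      unfolding qdiff by (rule pdiff)
    have 3: "(\<lambda>x. (q n x - hankel \<alpha> g x)\<^sup>2) \<in> borel_measurable ?M"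
      using meas hm by measurable
    have 4: "(\<lambda>m. (q n x - q (n + m) x)\<^sup>2) \<longlonglongrightarrow> (q n x - hankel \<alpha> g x)\<^sup>2" for x
    proof (intro tendsto_intros)
      show "(\<lambda>m. q (n + m) x) \<longlonglongrightarrow> hankel \<alpha> g x"
        using LIMSEQ_ignore_initial_segment[OF q_lim[of x], of n] by (simp add: add.commute)
    qed
    show "integrable ?M (\<lambda>x. (q n x - hankel \<alpha> g x)\<^sup>2)"
      "(LINT x|?M. (q n x - hankel \<alpha> g x)\<^sup>2) \<le> (2 * \<epsilon> n)\<^sup>2"
      using integral_le_of_tendsto[OF 1 zero_le_power2 2 3 4] by blast+
  qed
  show h2: "integrable ?M (\<lambda>x. (hankel \<alpha> g x)\<^sup>2)"
    using integrable_square_diff[of "q 0" ?M "\<lambda>x. q 0 x - hankel \<alpha> g x"] qh(1)[of 0] q2[of 0] meas hm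
    by simp
  have pg: "(LINT x|?M. (p n x - g x)\<^sup>2) \<le> (2 * \<epsilon> n)\<^sup>2" for n
  proof -
    have "(\<epsilon> n)\<^sup>2 \<le> (2 * \<epsilon> n)\<^sup>2"
      using \<epsilon>[of n] by (intro power_mono) auto
    from order_trans[OF gp(4) this] show ?thesis
      by (simp only: power2_commute)
  qed
  have d: "2 * \<epsilon> n > 0" "(\<lambda>n. 2 * \<epsilon> n) \<longlonglongrightarrow> 0" for n
    using \<epsilon> tendsto_mult_left[OF \<epsilon>_lim, of 2] by auto
  have "(\<lambda>n. LINT x|?M. (q n x)\<^sup>2) \<longlonglongrightarrow> (LINT x|?M. (hankel \<alpha> g x)\<^sup>2)"
    by (rule integral_square_tendsto[OF meas(2) hm q2 h2 qh(2) d])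
  moreover have "(\<lambda>n. LINT x|?M. (q n x)\<^sup>2) = (\<lambda>n. LINT x|?M. (p n x)\<^sup>2)"
    using parseval by (simp add: power2_eq_square)
  moreover have "(\<lambda>n. LINT x|?M. (p n x)\<^sup>2) \<longlonglongrightarrow> (LINT x|?M. (g x)\<^sup>2)"
    by (rule integral_square_tendsto[OF meas(1) meas(3) p2 g2 pg d])
  ultimately show "(LINT x|?M. (hankel \<alpha> g x)\<^sup>2) = (LINT x|?M. (g x)\<^sup>2)"
    using LIMSEQ_unique by metis
  show "has_fourier_bessel_L2 \<alpha> (\<lambda>x. complex_of_real (hankel \<alpha> g x)) (\<lambda>x. complex_of_real (g x))"
    unfolding has_fourier_bessel_L2_def
  proof (intro exI[of _ "\<lambda>n x. complex_of_real (q n x)"] conjI allI IntI)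
    show "(\<lambda>x. complex_of_real (q n x)) \<in> fb_Lp \<alpha> 2" for n
      by (rule of_real_in_fb_L2[OF q_meas q2])
    show "(\<lambda>x. complex_of_real (q n x)) \<in> fb_Lp \<alpha> 1" for n
      using q_int[of n] meas(2)[of n] by (simp add: fb_Lp_def)
    show "fb_converges \<alpha> 2 (\<lambda>n x. complex_of_real (q n x)) (\<lambda>x. complex_of_real (hankel \<alpha> g x))"
      by (rule fb_converges_of_real[OF q_meas h_meas q2 h2 qh(2) d])
    have "fourier_bessel \<alpha> (\<lambda>x. complex_of_real (q n x)) = (\<lambda>x. complex_of_real (p n x))" for n
      by (simp add: fourier_bessel_def hq[symmetric] hankel_def fun_eq_iff flip: of_real_mult)
    then show "fb_converges \<alpha> 2 (\<lambda>n. fourier_bessel \<alpha> (\<lambda>x. complex_of_real (q n x)))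
        (\<lambda>x. complex_of_real (g x))"
      using fb_converges_of_real[OF p_meas g_meas p2 g2 pg d] by simp
  qed
qed

section \<open>The Bessel operator and pointwise decay\<close>

lemma has_bochner_integral_fb_measure_lborel:
  fixes f :: "real \<Rightarrow> real"
  assumes "\<alpha> \<ge> 0" "f \<in> borel_measurable borel"
    and "has_bochner_integral lborel (\<lambda>x. indicator {0..} x * (fb_weight \<alpha> x * f x)) I"
  shows "has_bochner_integral (fb_measure \<alpha>) f I"
proof (rule has_bochner_integral_fb_measure[OF assms(1,2)])
  have meas: "(\<lambda>x. indicator {0..} x * (fb_weight \<alpha> x * f x)) \<in> borel_measurable lborel"
    using assms(3) by (rule borel_measurable_has_bochner_integral)
  show "has_bochner_integral lebesgue (\<lambda>x. indicator {0..} x * (fb_weight \<alpha> x * f x)) I"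
    using assms(3)
    unfolding has_bochner_integral_iff integrable_completion[OF meas] integral_completion[OF meas] .
qed

text \<open>
  The transform turns \<open>L = d\<^sup>2/dy\<^sup>2 + (2\<alpha>+1)/y d/dy\<close> into multiplication by \<open>-(2\<pi> x)\<^sup>2\<close>. With the weight
  \<open>y powr (2\<alpha>+1)\<close> the operator is symmetric, and Green's formula takes the form
  \<open>(y powr (2\<alpha>+1) (G' J - G J'))' = y powr (2\<alpha>+1) (L G \<cdot> J - G \<cdot> L J)\<close> for \<open>J(y) = j\<^sub>\<alpha>(2\<pi> x y)\<close>, with
  \<open>L J = -(2\<pi> x)\<^sup>2 J\<close>. The functions \<open>g\<close> and \<open>r\<close> only have to be given by \<open>G\<close> on \<open>[p, q]\<close>, so
  that \<open>G\<close> may be an expression that is smooth on the whole line.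
\<close>

lemma hankel_bessel_operator:
  fixes g r G G' G'' :: "real \<Rightarrow> real"
  assumes "\<alpha> \<ge> 0" "0 < p" "p \<le> q"
    and g: "continuous_on UNIV g" "\<And>y. y \<notin> {p..q} \<Longrightarrow> g y = 0"
    and r: "continuous_on UNIV r" "\<And>y. y \<notin> {p..q} \<Longrightarrow> r y = 0"
    and G: "\<And>y. (G has_real_derivative G' y) (at y)" "\<And>y. (G' has_real_derivative G'' y) (at y)"
    and ends: "G p = 0" "G' p = 0" "G q = 0" "G' q = 0"
    and gG: "\<And>y. y \<in> {p..q} \<Longrightarrow> g y = G y"
    and rG: "\<And>y. y \<in> {p..q} \<Longrightarrow> r y = G'' y + (2 * \<alpha> + 1) / y * G' y + c * G y"
    and x: "x \<ge> 0"
  shows "hankel \<alpha> r x = (c - (2 * pi * x)\<^sup>2) * hankel \<alpha> g x"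
proof -
  let ?k = "2 * pi * x" and ?m = "2 * \<alpha> + 1"
  let ?j = "\<lambda>y. bessel_j \<alpha> (?k * y)" and ?d = "\<lambda>y. bessel_dj \<alpha> (?k * y)"
  let ?M = "fb_measure \<alpha>" and ?C = "2 * pi powr (\<alpha> + 1) / Gamma (\<alpha> + 1)"
  define F where "F = (\<lambda>y. y powr ?m * (G' y * ?j y - G y * (?k * ?d y)))"
  define f where "f = (\<lambda>y. r y * ?j y + (?k\<^sup>2 - c) * (g y * ?j y))"
  have dF: "(F has_real_derivative y powr ?m * f y) (at y)" if y: "y \<in> {p..q}" for y
  proof -
    have y0: "y > 0" using y assms(2) by auto
    obtain D where D: "(bessel_dj \<alpha> has_real_derivative D) (at (?k * y))"
      "?k * y * D = - (?k * y) * ?j y - ?m * ?d y"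
      using bessel_ode[OF assms(1)] by blast
    have dj: "(?j has_real_derivative ?d y * ?k) (at y)"
      by (rule DERIV_chain2[OF DERIV_bessel_j[OF assms(1)]]) (auto intro!: derivative_eq_intros)
    have dd: "(?d has_real_derivative D * ?k) (at y)"
      by (rule DERIV_chain2[where f = "bessel_dj \<alpha>" and g = "\<lambda>y. ?k * y", OF D(1)])
         (auto intro!: derivative_eq_intros)
    have dQ: "((\<lambda>y. G' y * ?j y - G y * (?k * ?d y)) has_real_derivative
        (G' y * (?d y * ?k) + G'' y * ?j y) - (G y * (?k * (D * ?k)) + G' y * (?k * ?d y))) (at y)"
      by (intro DERIV_diff DERIV_mult' DERIV_cmult dj dd G)
    have "(F has_real_derivative
        y powr ?m * ((G' y * (?d y * ?k) + G'' y * ?j y) - (G y * (?k * (D * ?k)) + G' y * (?k * ?d y)))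
        + ?m * y powr (?m - 1) * (G' y * ?j y - G y * (?k * ?d y))) (at y)"
      unfolding F_def by (rule DERIV_mult'[OF has_real_derivative_powr[OF y0] dQ])
    also have "y powr ?m * ((G' y * (?d y * ?k) + G'' y * ?j y) - (G y * (?k * (D * ?k)) + G' y * (?k * ?d y)))
        + ?m * y powr (?m - 1) * (G' y * ?j y - G y * (?k * ?d y)) = y powr ?m * f y"
    proof -
      have p: "y powr (?m - 1) = y powr ?m / y"
        using y0 powr_diff[of y ?m 1] by simp
      have kD: "?k * D = - ?k * ?j y - ?m / y * ?d y"
        using D(2) y0 by (simp add: field_simps)
      have "G y * (?k * (D * ?k)) = G y * ?k * (?k * D)"
        by (simp only: mult_ac)
      then have D': "G y * (?k * (D * ?k)) = G y * ?k * (- ?k * ?j y - ?m / y * ?d y)"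
        unfolding kD .
      show ?thesis
        unfolding p f_def D' gG[OF y] rG[OF y]
        by (simp add: algebra_simps power2_eq_square add_divide_distrib diff_divide_distrib)
    qed
    finally show ?thesis .
  qed
  have fc: "continuous_on UNIV f"
    unfolding f_def
    by (intro continuous_intros g r continuous_on_compose2[OF continuous_bessel_j(1)[OF assms(1)]] subset_UNIV)
  have "has_bochner_integral lborel (\<lambda>y. indicator {p..q} y *\<^sub>R (y powr ?m * f y)) (F q - F p)"
  proof (rule has_bochner_integral_FTC_Icc[OF assms(3)])
    show "(F has_vector_derivative y powr ?m * f y) (at y within {p..q})" if "p \<le> y" "y \<le> q" for y
      using dF[of y] that
      by (auto simp: has_real_derivative_iff_has_vector_derivative intro: has_vector_derivative_at_within)
    show "continuous_on {p..q} (\<lambda>y. y powr ?m * f y)"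
      using assms(2) by (intro continuous_intros continuous_on_subset[OF fc]) auto
  qed
  moreover have "F q = 0" "F p = 0"
    by (simp_all add: F_def ends)
  ultimately have "has_bochner_integral lborel (\<lambda>y. indicator {p..q} y *\<^sub>R (y powr ?m * f y)) 0"
    by simp
  from has_bochner_integral_mult_right[OF this, of ?C]
  have "has_bochner_integral lborel (\<lambda>y. ?C * (indicator {p..q} y *\<^sub>R (y powr ?m * f y))) 0"
    by simp
  also have "(\<lambda>y. ?C * (indicator {p..q} y *\<^sub>R (y powr ?m * f y)))
      = (\<lambda>y. indicator {0..} y * (fb_weight \<alpha> y * f y))"
  proof
    fix y
    show "?C * (indicator {p..q} y *\<^sub>R (y powr ?m * f y)) = indicator {0..} y * (fb_weight \<alpha> y * f y)"
    proof (cases "y \<in> {p..q}")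
      case True
      then show ?thesis
        using assms(2) by (simp add: fb_weight_def indicator_def)
    next
      case False
      then show ?thesis
        using g(2)[OF False] r(2)[OF False] by (simp add: f_def indicator_def)
    qed
  qed
  finally have "has_bochner_integral ?M f 0"
    by (rule has_bochner_integral_fb_measure_lborel[OF assms(1) borel_measurable_continuous_onI[OF fc]])
  then have "integral\<^sup>L ?M f = 0"
    by (rule has_bochner_integral_integral_eq)
  have int: "integrable ?M (\<lambda>y. h y * ?j y)"
    if "continuous_on UNIV h" "\<And>y. y \<notin> {p..q} \<Longrightarrow> h y = 0" for h
  proof -
    have "integrable ?M h"
      using that(2) assms(2,3) by (intro hankel_plancherel(2)[OF assms(1) that(1), of "q + 1"]) auto
    from integrable_mult_bessel_j[OF assms(1) this, of x] show ?thesis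
      by (simp add: mult_ac)
  qed
  have hank: "hankel \<alpha> h x = (LINT y|?M. h y * ?j y)" for h
    by (simp add: hankel_def mult_ac)
  have "integral\<^sup>L ?M f = hankel \<alpha> r x + (?k\<^sup>2 - c) * hankel \<alpha> g x"
    unfolding f_def hank using int[OF r] int[OF g] by simp
  with \<open>integral\<^sup>L ?M f = 0\<close> show ?thesis
    by (simp add: algebra_simps)
qed

text \<open>
  On the support of \<open>g\<close> the argument \<open>2\<pi> x y\<close> is at least \<open>p x\<close>, so the decay of the Bessel function
  passes to the transform.
\<close>

lemma hankel_decay:
  assumes "\<alpha> \<ge> 0" "p > 0"
  obtains C where "C > 0"
    "\<And>g x. integrable (fb_measure \<alpha>) g \<Longrightarrow> (\<And>y. y < p \<Longrightarrow> g y = 0) \<Longrightarrow> x > 0 \<Longrightarrow>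
      x powr (2 * \<alpha> + 1) * (hankel \<alpha> g x)\<^sup>2 \<le> C * (LINT y|fb_measure \<alpha>. \<bar>g y\<bar>)\<^sup>2"
proof -
  let ?m = "2 * \<alpha> + 1"
  obtain C where C: "C > 0" "\<And>z. z \<ge> 0 \<Longrightarrow> z powr ?m * (bessel_j \<alpha> z)\<^sup>2 \<le> C"
    using bessel_j_decay[OF assms(1)] by blast
  have "x powr ?m * (hankel \<alpha> g x)\<^sup>2 \<le> C / p powr ?m * (LINT y|fb_measure \<alpha>. \<bar>g y\<bar>)\<^sup>2"
    if g: "integrable (fb_measure \<alpha>) g" "\<And>y. y < p \<Longrightarrow> g y = 0" and x: "x > 0" for g x
  proof -
    define s where "s = sqrt (C / (p * x) powr ?m)"
    have px: "(p * x) powr ?m > 0" using assms x by simp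
    have j: "\<bar>bessel_j \<alpha> (2 * pi * x * y)\<bar> \<le> s" if "y \<ge> p" for y
    proof -
      have "1 * (p * x) \<le> 2 * pi * (y * x)"
        using that x assms(2) pi_ge_two by (intro mult_mono) auto
      then have "(p * x) powr ?m * (bessel_j \<alpha> (2 * pi * x * y))\<^sup>2
          \<le> (2 * pi * x * y) powr ?m * (bessel_j \<alpha> (2 * pi * x * y))\<^sup>2"
        using assms x by (intro mult_right_mono powr_mono2) (auto simp: mult_ac)
      also have "\<dots> \<le> C"
        using that x assms by (intro C(2)) auto
      finally have "(bessel_j \<alpha> (2 * pi * x * y))\<^sup>2 \<le> C / (p * x) powr ?m"
        using px by (simp add: pos_le_divide_eq mult.commute)
      from real_sqrt_le_mono[OF this] show ?thesis by (simp add: s_def)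
    qed
    have "\<bar>hankel \<alpha> g x\<bar> \<le> (LINT y|fb_measure \<alpha>. norm (g y * bessel_j \<alpha> (2 * pi * y * x)))"
      unfolding hankel_def real_norm_def[symmetric] by (rule integral_norm_bound)
    also have "\<dots> \<le> (LINT y|fb_measure \<alpha>. \<bar>g y\<bar> * s)"
    proof (rule integral_mono)
      show "integrable (fb_measure \<alpha>) (\<lambda>y. norm (g y * bessel_j \<alpha> (2 * pi * y * x)))"
        by (rule integrable_norm[OF integrable_mult_bessel_j[OF assms(1) g(1)]])
      show "integrable (fb_measure \<alpha>) (\<lambda>y. \<bar>g y\<bar> * s)"
        by (rule integrable_mult_left[OF integrable_abs[OF g(1)]])
      show "norm (g y * bessel_j \<alpha> (2 * pi * y * x)) \<le> \<bar>g y\<bar> * s" for y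
      proof (cases "y \<ge> p")
        case True
        from mult_left_mono[OF j[OF this], of "\<bar>g y\<bar>"] show ?thesis
          by (simp add: abs_mult mult_ac)
      qed (use g(2)[of y] in simp)
    qed
    also have "\<dots> = s * (LINT y|fb_measure \<alpha>. \<bar>g y\<bar>)"
      by (simp add: mult.commute)
    finally have "(hankel \<alpha> g x)\<^sup>2 \<le> s\<^sup>2 * (LINT y|fb_measure \<alpha>. \<bar>g y\<bar>)\<^sup>2"
      using power_mono[of "\<bar>hankel \<alpha> g x\<bar>" "s * (LINT y|fb_measure \<alpha>. \<bar>g y\<bar>)" 2]
      by (simp add: power_mult_distrib)
    also have "s\<^sup>2 = C / (p * x) powr ?m"
      using C px by (simp add: s_def)
    finally have "x powr ?m * (hankel \<alpha> g x)\<^sup>2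
        \<le> x powr ?m * (C / (p * x) powr ?m * (LINT y|fb_measure \<alpha>. \<bar>g y\<bar>)\<^sup>2)"
      by (rule mult_left_mono) auto
    also have "\<dots> = C / p powr ?m * (LINT y|fb_measure \<alpha>. \<bar>g y\<bar>)\<^sup>2"
      using assms x by (simp add: powr_mult)
    finally show ?thesis .
  qed
  moreover have "C / p powr ?m > 0" using C assms by simp
  ultimately show thesis using that by blast
qed

section \<open>Wave packets\<close>

text \<open>
  The cube makes the bump twice continuously differentiable with all three functions vanishing at the
  end points \<open>b/2\<close> and \<open>b\<close>. Its support avoids \<open>0\<close>, where \<open>1/y\<close> and the bound on the Bessel function
  degenerate.
\<close>

definition bump :: "real \<Rightarrow> real \<Rightarrow> real" where
  "bump b y = (max 0 ((y - b / 2) * (b - y))) ^ 3"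

definition bump' :: "real \<Rightarrow> real \<Rightarrow> real" where
  "bump' b y = 3 * (max 0 ((y - b / 2) * (b - y)))\<^sup>2 * (3 * b / 2 - 2 * y)"

definition bump'' :: "real \<Rightarrow> real \<Rightarrow> real" where
  "bump'' b y = 6 * max 0 ((y - b / 2) * (b - y)) * (3 * b / 2 - 2 * y)\<^sup>2
     - 6 * (max 0 ((y - b / 2) * (b - y)))\<^sup>2"

definition packet :: "real \<Rightarrow> real \<Rightarrow> real \<Rightarrow> real \<Rightarrow> real" where
  "packet b \<omega> \<theta> y = bump b y * cos (\<omega> * y - \<theta>)"

text \<open>
  This is \<open>L + \<omega>\<^sup>2\<close> applied to the packet: the term with \<open>\<omega>\<^sup>2\<close> has cancelled. Writing \<open>max (b/2) y\<close>
  for \<open>y\<close> changes nothing on the support and makes the formula continuous on the whole line.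
\<close>

definition packet_op :: "real \<Rightarrow> real \<Rightarrow> real \<Rightarrow> real \<Rightarrow> real \<Rightarrow> real" where
  "packet_op \<alpha> b \<omega> \<theta> y =
     (bump'' b y + (2 * \<alpha> + 1) / max (b / 2) y * bump' b y) * cos (\<omega> * y - \<theta>)
     - \<omega> * (2 * bump' b y + (2 * \<alpha> + 1) / max (b / 2) y * bump b y) * sin (\<omega> * y - \<theta>)"

lemma continuous_bump:
  assumes "b > 0"
  shows "continuous_on UNIV (bump b)" "continuous_on UNIV (bump' b)" "continuous_on UNIV (bump'' b)"
    "continuous_on UNIV (packet b \<omega> \<theta>)" "continuous_on UNIV (packet_op \<alpha> b \<omega> \<theta>)"
proof -
  show c: "continuous_on UNIV (bump b)" "continuous_on UNIV (bump' b)" "continuous_on UNIV (bump'' b)"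
    unfolding bump_def[abs_def] bump'_def[abs_def] bump''_def[abs_def] by (intro continuous_intros)+
  show "continuous_on UNIV (packet b \<omega> \<theta>)"
    unfolding packet_def[abs_def] by (intro continuous_intros c)
  have "max (b / 2) y \<noteq> 0" for y
    using assms by (simp add: max_def)
  then show "continuous_on UNIV (packet_op \<alpha> b \<omega> \<theta>)"
    unfolding packet_op_def[abs_def] by (intro continuous_intros c ballI)
qed

lemma bump_outside:
  assumes "b > 0" "y \<notin> {b / 2..b}"
  shows "bump b y = 0" "bump' b y = 0" "bump'' b y = 0" "packet b \<omega> \<theta> y = 0" "packet_op \<alpha> b \<omega> \<theta> y = 0"
proof -
  have "(y - b / 2) * (b - y) \<le> 0"
    using assms by (auto simp: mult_le_0_iff)
  then have "max 0 ((y - b / 2) * (b - y)) = 0" by simp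
  then show "bump b y = 0" "bump' b y = 0" "bump'' b y = 0" "packet b \<omega> \<theta> y = 0" "packet_op \<alpha> b \<omega> \<theta> y = 0"
    by (simp_all add: bump_def bump'_def bump''_def packet_def packet_op_def)
qed

lemma packet_plancherel:
  assumes "\<alpha> \<ge> 0" "b > 0" "continuous_on UNIV g" "\<And>y. y \<notin> {b / 2..b} \<Longrightarrow> g y = 0"
  shows "hankel \<alpha> g \<in> borel_measurable borel"
    and "integrable (fb_measure \<alpha>) g"
    and "integrable (fb_measure \<alpha>) (\<lambda>x. (hankel \<alpha> g x)\<^sup>2)"
    and "(LINT x|fb_measure \<alpha>. (hankel \<alpha> g x)\<^sup>2) = (LINT x|fb_measure \<alpha>. (g x)\<^sup>2)"
    and "has_fourier_bessel_L2 \<alpha> (\<lambda>x. complex_of_real (hankel \<alpha> g x)) (\<lambda>x. complex_of_real (g x))"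
  using hankel_plancherel[OF assms(1,3), of "b + 1"] assms(2,4) by auto

lemma packet_support:
  assumes "\<alpha> \<ge> 0" "b > 0"
  shows "fb_supp_within \<alpha> (\<lambda>x. complex_of_real (hankel \<alpha> (packet b \<omega> \<theta>) x)) {0..b}"
  unfolding fb_supp_within_def
proof (intro exI conjI)
  show "has_fourier_bessel_L2 \<alpha> (\<lambda>x. complex_of_real (hankel \<alpha> (packet b \<omega> \<theta>) x))
      (\<lambda>x. complex_of_real (packet b \<omega> \<theta> x))"
    using assms by (intro packet_plancherel(5) continuous_bump bump_outside)
  show "AE y in fb_measure \<alpha>. y \<notin> {0..b} \<longrightarrow> complex_of_real (packet b \<omega> \<theta> y) = 0"
  proof (rule AE_I2, rule impI)
    fix y assume "y \<notin> {0..b}"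
    then have "y \<notin> {b / 2..b}" using assms(2) by auto
    then show "complex_of_real (packet b \<omega> \<theta> y) = 0"
      using bump_outside(4)[OF assms(2)] by simp
  qed
qed

lemma hankel_packet_op:
  assumes "\<alpha> \<ge> 0" "b > 0" "x \<ge> 0"
  shows "hankel \<alpha> (packet_op \<alpha> b \<omega> \<theta>) x = (\<omega>\<^sup>2 - (2 * pi * x)\<^sup>2) * hankel \<alpha> (packet b \<omega> \<theta>) x"
proof -
  let ?s = "\<lambda>y. (y - b / 2) * (b - y)" and ?r = "\<lambda>y. 3 * b / 2 - 2 * y"
  let ?c = "\<lambda>y. cos (\<omega> * y - \<theta>)" and ?n = "\<lambda>y. sin (\<omega> * y - \<theta>)"
  let ?P0 = "\<lambda>y. ?s y ^ 3" and ?P1 = "\<lambda>y. 3 * (?s y)\<^sup>2 * ?r y"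
    and ?P2 = "\<lambda>y. 6 * ?s y * (?r y)\<^sup>2 - 6 * (?s y)\<^sup>2"
  let ?G = "\<lambda>y. ?P0 y * ?c y" and ?G' = "\<lambda>y. ?P1 y * ?c y - \<omega> * (?P0 y * ?n y)"
    and ?G'' = "\<lambda>y. ?P2 y * ?c y - 2 * \<omega> * (?P1 y * ?n y) - \<omega>\<^sup>2 * (?P0 y * ?c y)"
  have s: "(?s has_real_derivative ?r y) (at y)" for y
    by (auto intro!: derivative_eq_intros simp: field_simps)
  have r: "(?r has_real_derivative -2) (at y)" for y
    by (auto intro!: derivative_eq_intros)
  have P0: "(?P0 has_real_derivative ?P1 y) (at y)" for y
    using DERIV_power[OF s, of 3 y] by (simp add: mult_ac)
  have P1: "(?P1 has_real_derivative ?P2 y) (at y)" for y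
  proof -
    have sq: "((\<lambda>y. (?s y)\<^sup>2) has_real_derivative ?s y * ?r y + ?r y * ?s y) (at y)"
      unfolding power2_eq_square by (rule DERIV_mult'[OF s s])
    have "3 * s\<^sup>2 * (- 2) + 3 * (s * r + r * s) * r = 6 * s * r\<^sup>2 - 6 * s\<^sup>2" for s r :: real
      by (simp add: power2_eq_square algebra_simps)
    then show ?thesis
      by (rule DERIV_cong[OF DERIV_mult'[OF DERIV_cmult[OF sq, of 3] r]])
  qed
  have c: "(?c has_real_derivative - \<omega> * ?n y) (at y)" and n: "(?n has_real_derivative \<omega> * ?c y) (at y)" for y
    by (auto intro!: derivative_eq_intros)
  have G: "(?G has_real_derivative ?G' y) (at y)" for y
  proof (rule DERIV_cong[OF DERIV_mult'[OF P0 c]])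
    show "u * (- \<omega> * k) + v * l = v * l - \<omega> * (u * k)" for u v k l :: real
      by simp
  qed
  have G': "(?G' has_real_derivative ?G'' y) (at y)" for y
  proof (rule DERIV_cong[OF DERIV_diff[OF DERIV_mult'[OF P1 c] DERIV_cmult[OF DERIV_mult'[OF P0 n], of \<omega>]]])
    show "v * (- \<omega> * k) + w * l - \<omega> * (u * (\<omega> * l) + v * k)
        = w * l - 2 * \<omega> * (v * k) - \<omega>\<^sup>2 * (u * l)" for u v w k l :: real
      by (simp add: power2_eq_square algebra_simps)
  qed
  have m: "max 0 (?s y) = ?s y" "max (b / 2) y = y" if "y \<in> {b / 2..b}" for y
    using that by (auto intro!: mult_nonneg_nonneg max_absorb2)
  show ?thesis
  proof (rule hankel_bessel_operator[OF assms(1), where p = "b / 2" and q = b and G = ?G and G' = ?G' and G'' = ?G''])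
    show "packet b \<omega> \<theta> y = ?G y" if "y \<in> {b / 2..b}" for y
      by (simp only: packet_def bump_def m[OF that])
    show "packet_op \<alpha> b \<omega> \<theta> y = ?G'' y + (2 * \<alpha> + 1) / y * ?G' y + \<omega>\<^sup>2 * ?G y" if "y \<in> {b / 2..b}" for y
      unfolding packet_op_def bump_def bump'_def bump''_def m[OF that] by algebra
  qed (use assms G G' continuous_bump[OF assms(2)] bump_outside[OF assms(2)] in auto)
qed

text \<open>
  By Plancherel the weighted energy is a multiple of that of \<open>packet_op\<close>, which is \<open>A cos - \<omega> B sin\<close> with
  \<open>A\<close> and \<open>B\<close> independent of the frequency and the phase, hence of order \<open>\<omega>\<^sup>2\<close>.
\<close>

lemma packet_concentration:
  assumes "\<alpha> \<ge> 0" "b > 0"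
  obtains T where "T > 0"
    "\<And>x0 \<theta>. x0 \<ge> 1 \<Longrightarrow>
      integrable (fb_measure \<alpha>) (\<lambda>x. ((x\<^sup>2 - x0\<^sup>2) * hankel \<alpha> (packet b (2 * pi * x0) \<theta>) x)\<^sup>2)"
    "\<And>x0 \<theta>. x0 \<ge> 1 \<Longrightarrow>
      (LINT x|fb_measure \<alpha>. ((x\<^sup>2 - x0\<^sup>2) * hankel \<alpha> (packet b (2 * pi * x0) \<theta>) x)\<^sup>2) \<le> T * x0\<^sup>2"
proof -
  let ?M = "fb_measure \<alpha>"
  define A where "A = (\<lambda>y. bump'' b y + (2 * \<alpha> + 1) / max (b / 2) y * bump' b y)"
  define B where "B = (\<lambda>y. 2 * bump' b y + (2 * \<alpha> + 1) / max (b / 2) y * bump b y)"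
  have AB: "packet_op \<alpha> b \<omega> \<theta> y = A y * cos (\<omega> * y - \<theta>) - \<omega> * B y * sin (\<omega> * y - \<theta>)" for \<omega> \<theta> y
    by (simp add: packet_op_def A_def B_def)
  have "max (b / 2) y \<noteq> 0" for y
    using assms by (simp add: max_def)
  then have "continuous_on UNIV (\<lambda>y. (A y)\<^sup>2 + (B y)\<^sup>2)"
    unfolding A_def B_def by (intro continuous_intros continuous_bump[OF assms(2)] ballI)
  moreover have "(A y)\<^sup>2 + (B y)\<^sup>2 = 0" if "y \<notin> {b / 2..b}" for y
    using bump_outside[OF assms(2) that] by (simp add: A_def B_def)
  ultimately have iAB: "integrable ?M (\<lambda>y. (A y)\<^sup>2 + (B y)\<^sup>2)"
    by (rule packet_plancherel(2)[OF assms])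
  define N where "N = (LINT y|?M. (A y)\<^sup>2 + (B y)\<^sup>2)"
  have N: "N \<ge> 0" unfolding N_def by (intro Bochner_Integration.integral_nonneg) auto
  have main: "integrable ?M (\<lambda>x. ((x\<^sup>2 - x0\<^sup>2) * hankel \<alpha> (packet b (2 * pi * x0) \<theta>) x)\<^sup>2) \<and>
      (LINT x|?M. ((x\<^sup>2 - x0\<^sup>2) * hankel \<alpha> (packet b (2 * pi * x0) \<theta>) x)\<^sup>2) \<le> (N + 1) * x0\<^sup>2"
    if x0: "x0 \<ge> 1" for x0 \<theta>
  proof -
    let ?\<omega> = "2 * pi * x0"
    let ?h = "hankel \<alpha> (packet_op \<alpha> b ?\<omega> \<theta>)"
    note op = packet_plancherel[where g = "packet_op \<alpha> b ?\<omega> \<theta>",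
        OF assms continuous_bump(5)[OF assms(2)] bump_outside(5)[OF assms(2)]]
    have \<omega>: "?\<omega> \<ge> 1"
      using mult_mono[of 1 "2 * pi" 1 x0] x0 pi_ge_two by auto
    have eq: "((x\<^sup>2 - x0\<^sup>2) * hankel \<alpha> (packet b ?\<omega> \<theta>) x)\<^sup>2 = (?h x)\<^sup>2 / (16 * pi ^ 4)"
      if "x \<ge> 0" for x
    proof -
      have "?h x = - (4 * pi\<^sup>2) * ((x\<^sup>2 - x0\<^sup>2) * hankel \<alpha> (packet b ?\<omega> \<theta>) x)"
        unfolding hankel_packet_op[OF assms that] by (simp add: power_mult_distrib algebra_simps)
      then have "(?h x)\<^sup>2 = (4 * pi\<^sup>2)\<^sup>2 * ((x\<^sup>2 - x0\<^sup>2) * hankel \<alpha> (packet b ?\<omega> \<theta>) x)\<^sup>2"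
        by (simp only: power_mult_distrib power2_minus)
      moreover have "(4 * pi\<^sup>2)\<^sup>2 = 16 * pi ^ 4"
        by (simp add: power_mult_distrib flip: power_mult)
      ultimately show ?thesis by simp
    qed
    have 1: "integrable ?M (\<lambda>x. ((x\<^sup>2 - x0\<^sup>2) * hankel \<alpha> (packet b ?\<omega> \<theta>) x)\<^sup>2)"
      using Bochner_Integration.integrable_divide[OF op(3), of "16 * pi ^ 4"] eq
      by (subst Bochner_Integration.integrable_cong[OF refl, where g = "\<lambda>x. (?h x)\<^sup>2 / (16 * pi ^ 4)"]) auto
    have "(LINT x|?M. (?h x)\<^sup>2) = (LINT x|?M. (packet_op \<alpha> b ?\<omega> \<theta> x)\<^sup>2)"
      by (rule op(4))
    also have "\<dots> \<le> (LINT x|?M. 2 * ?\<omega>\<^sup>2 * ((A x)\<^sup>2 + (B x)\<^sup>2))"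
    proof (rule integral_mono)
      show "integrable ?M (\<lambda>x. 2 * ?\<omega>\<^sup>2 * ((A x)\<^sup>2 + (B x)\<^sup>2))"
        by (rule integrable_mult_right[OF iAB])
      show "integrable ?M (\<lambda>x. (packet_op \<alpha> b ?\<omega> \<theta> x)\<^sup>2)"
      proof (rule packet_plancherel(2)[OF assms])
        show "continuous_on UNIV (\<lambda>x. (packet_op \<alpha> b ?\<omega> \<theta> x)\<^sup>2)"
          by (intro continuous_intros continuous_bump[OF assms(2)])
      qed (simp add: bump_outside[OF assms(2)])
      show "(packet_op \<alpha> b ?\<omega> \<theta> x)\<^sup>2 \<le> 2 * ?\<omega>\<^sup>2 * ((A x)\<^sup>2 + (B x)\<^sup>2)" for x
      proof -
        let ?u = "A x * cos (?\<omega> * x - \<theta>)" and ?v = "?\<omega> * B x * sin (?\<omega> * x - \<theta>)"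
        have "(?u - ?v)\<^sup>2 \<le> 2 * ?u\<^sup>2 + 2 * ?v\<^sup>2"
          using zero_le_power2[of "?u + ?v"] by (simp add: power2_eq_square algebra_simps)
        moreover have "?u\<^sup>2 \<le> ?\<omega>\<^sup>2 * (A x)\<^sup>2"
        proof -
          have "?u\<^sup>2 \<le> 1 * (A x)\<^sup>2"
            by (simp add: power_mult_distrib abs_square_le_1 mult_left_le)
          also have "\<dots> \<le> ?\<omega>\<^sup>2 * (A x)\<^sup>2"
            using \<omega> by (intro mult_right_mono) (auto simp: one_le_power)
          finally show ?thesis .
        qed
        moreover have "?v\<^sup>2 \<le> ?\<omega>\<^sup>2 * (B x)\<^sup>2"
        proof -
          have "?v\<^sup>2 = (?\<omega> * B x)\<^sup>2 * (sin (?\<omega> * x - \<theta>))\<^sup>2"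
            by (simp only: power_mult_distrib)
          also have "\<dots> \<le> (?\<omega> * B x)\<^sup>2"
            by (intro mult_left_le) (auto simp: abs_square_le_1)
          finally show ?thesis by (simp only: power_mult_distrib)
        qed
        moreover have "2 * ?\<omega>\<^sup>2 * ((A x)\<^sup>2 + (B x)\<^sup>2) = 2 * (?\<omega>\<^sup>2 * (A x)\<^sup>2) + 2 * (?\<omega>\<^sup>2 * (B x)\<^sup>2)"
          by (simp only: distrib_left mult.assoc)
        ultimately show ?thesis
          unfolding AB by linarith
      qed
    qed
    also have "\<dots> = 2 * ?\<omega>\<^sup>2 * N"
      unfolding N_def by (rule integral_mult_right_zero)
    finally have "(LINT x|?M. (?h x)\<^sup>2) \<le> 8 * pi\<^sup>2 * (N * x0\<^sup>2)"
      by (simp add: power_mult_distrib mult_ac)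
    also have "\<dots> \<le> 16 * pi ^ 4 * ((N + 1) * x0\<^sup>2)"
    proof (rule mult_mono)
      have "1 \<le> pi\<^sup>2"
        using pi_ge_two by (intro one_le_power) auto
      then have "8 * pi\<^sup>2 \<le> 16 * pi\<^sup>2 * pi\<^sup>2"
        by (intro mult_right_mono) auto
      then show "8 * pi\<^sup>2 \<le> 16 * pi ^ 4"
        by (simp add: power_numeral_reduce mult.assoc)
    qed (use N in \<open>auto intro!: mult_right_mono\<close>)
    finally have "(LINT x|?M. (?h x)\<^sup>2) / (16 * pi ^ 4) \<le> (N + 1) * x0\<^sup>2"
      by (simp add: pos_divide_le_eq mult_ac)
    moreover have "(LINT x|?M. ((x\<^sup>2 - x0\<^sup>2) * hankel \<alpha> (packet b ?\<omega> \<theta>) x)\<^sup>2)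
        = (LINT x|?M. (?h x)\<^sup>2) / (16 * pi ^ 4)"
      unfolding integral_divide_zero[symmetric]
      by (rule Bochner_Integration.integral_cong[OF refl]) (use eq in auto)
    ultimately show ?thesis using 1 by simp
  qed
  show thesis
    by (rule that[of "N + 1"]) (use N main in auto)
qed

lemma packet_decay:
  assumes "\<alpha> \<ge> 0" "b > 0"
  obtains D where "D > 0"
    "\<And>\<omega> \<theta> x. x > 0 \<Longrightarrow> x powr (2 * \<alpha> + 1) * (hankel \<alpha> (packet b \<omega> \<theta>) x)\<^sup>2 \<le> D"
proof -
  let ?M = "fb_measure \<alpha>"
  obtain C where C: "C > 0"
    "\<And>g x. integrable ?M g \<Longrightarrow> (\<And>y. y < b / 2 \<Longrightarrow> g y = 0) \<Longrightarrow> x > 0 \<Longrightarrow>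
      x powr (2 * \<alpha> + 1) * (hankel \<alpha> g x)\<^sup>2 \<le> C * (LINT y|?M. \<bar>g y\<bar>)\<^sup>2"
    using hankel_decay[OF assms(1), of "b / 2"] assms(2) by auto
  define N where "N = (LINT y|?M. \<bar>bump b y\<bar>)"
  have ib: "integrable ?M (bump b)"
    using assms by (intro packet_plancherel(2)[OF assms] continuous_bump bump_outside)
  have "x powr (2 * \<alpha> + 1) * (hankel \<alpha> (packet b \<omega> \<theta>) x)\<^sup>2 \<le> C * N\<^sup>2 + 1" if "x > 0" for \<omega> \<theta> x
  proof -
    have ip: "integrable ?M (packet b \<omega> \<theta>)"
      using assms by (intro packet_plancherel(2)[OF assms] continuous_bump bump_outside)
    have "packet b \<omega> \<theta> y = 0" if "y < b / 2" for y
      using bump_outside(4)[OF assms(2), of y] that by auto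
    note 1 = C(2)[OF ip this \<open>x > 0\<close>]
    have "(LINT y|?M. \<bar>packet b \<omega> \<theta> y\<bar>) \<le> N"
      unfolding N_def
    proof (intro integral_mono integrable_abs ip ib)
      show "\<bar>packet b \<omega> \<theta> y\<bar> \<le> \<bar>bump b y\<bar>" for y
        by (simp add: packet_def abs_mult mult_left_le)
    qed
    then have "C * (LINT y|?M. \<bar>packet b \<omega> \<theta> y\<bar>)\<^sup>2 \<le> C * N\<^sup>2"
      using C(1) by (intro mult_left_mono power_mono Bochner_Integration.integral_nonneg) auto
    with 1 show ?thesis by simp
  qed
  moreover have "C * N\<^sup>2 + 1 > 0"
    using C(1) by (simp add: add_nonneg_pos)
  ultimately show thesis using that by blast
qed

text \<open>
  The energy of one packet depends on frequency and phase. Phases a quarter period apart complement each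
  other by \<open>cos\<^sup>2 + sin\<^sup>2 = 1\<close>, leaving the energy of the bump.
\<close>

lemma packet_energy:
  assumes "\<alpha> \<ge> 0" "b > 0"
  obtains N where "N > 0"
    "\<And>\<omega>. (LINT x|fb_measure \<alpha>. (hankel \<alpha> (packet b \<omega> 0) x)\<^sup>2)
        + (LINT x|fb_measure \<alpha>. (hankel \<alpha> (packet b \<omega> (pi / 2)) x)\<^sup>2) = N"
proof -
  let ?M = "fb_measure \<alpha>"
  define N where "N = (LINT x|?M. (bump b x)\<^sup>2)"
  have int: "integrable ?M (\<lambda>x. (g x)\<^sup>2)"
    if "continuous_on UNIV g" "\<And>y. y \<notin> {b / 2..b} \<Longrightarrow> g y = 0" for g :: "real \<Rightarrow> real"
  proof (rule packet_plancherel(2)[OF assms])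
    show "continuous_on UNIV (\<lambda>x. (g x)\<^sup>2)" by (intro continuous_intros that)
  qed (simp add: that(2))
  have eq: "(LINT x|?M. (hankel \<alpha> (packet b \<omega> 0) x)\<^sup>2)
      + (LINT x|?M. (hankel \<alpha> (packet b \<omega> (pi / 2)) x)\<^sup>2) = N" for \<omega>
  proof -
    have p: "integrable ?M (\<lambda>x. (packet b \<omega> \<theta> x)\<^sup>2)" for \<theta>
      using continuous_bump(4)[OF assms(2)] bump_outside(4)[OF assms(2)] by (rule int)
    have "(LINT x|?M. (hankel \<alpha> (packet b \<omega> \<theta>) x)\<^sup>2) = (LINT x|?M. (packet b \<omega> \<theta> x)\<^sup>2)" for \<theta>
      using continuous_bump(4)[OF assms(2)] bump_outside(4)[OF assms(2)]
      by (rule packet_plancherel(4)[OF assms])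
    moreover have "(packet b \<omega> 0 x)\<^sup>2 + (packet b \<omega> (pi / 2) x)\<^sup>2 = (bump b x)\<^sup>2" for x
    proof -
      have "cos (\<omega> * x - pi / 2) = sin (\<omega> * x)"
        by (simp add: cos_diff)
      moreover have "(bump b x)\<^sup>2 * (cos (\<omega> * x))\<^sup>2 + (bump b x)\<^sup>2 * (sin (\<omega> * x))\<^sup>2 = (bump b x)\<^sup>2"
        by (simp flip: distrib_left)
      ultimately show ?thesis
        by (simp add: packet_def power_mult_distrib)
    qed
    ultimately show ?thesis
      unfolding N_def using Bochner_Integration.integral_add[OF p p, of 0 "pi / 2"] by simp
  qed
  have "N \<ge> 0" unfolding N_def by (intro Bochner_Integration.integral_nonneg) auto
  moreover have "N \<noteq> 0"
  proof
    assume "N = 0"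
    have "integrable ?M (\<lambda>x. (bump b x)\<^sup>2)"
      using continuous_bump(1)[OF assms(2)] bump_outside(1)[OF assms(2)] by (rule int)
    then have "AE x in ?M. (bump b x)\<^sup>2 = 0"
      using \<open>N = 0\<close> unfolding N_def by (subst (asm) integral_nonneg_eq_0_iff_AE) auto
    then have "AE x in lebesgue_on {0..}. 0 < ennreal (fb_weight \<alpha> x) \<longrightarrow> (bump b x)\<^sup>2 = 0"
      unfolding fb_measure_eq
      by (subst (asm) AE_density) (auto intro!: measurable_compose[OF borel_measurable_lebesgue_on measurable_ennreal])
    then have "AE x in lebesgue. x \<in> {0..} \<longrightarrow> 0 < ennreal (fb_weight \<alpha> x) \<longrightarrow> (bump b x)\<^sup>2 = 0"
      by (subst (asm) AE_restrict_space_iff) auto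
    then have "AE x in lebesgue. x \<notin> {b / 2<..<b}"
    proof (rule AE_mp, intro AE_I2 impI notI)
      fix x assume *: "x \<in> {0..} \<longrightarrow> 0 < ennreal (fb_weight \<alpha> x) \<longrightarrow> (bump b x)\<^sup>2 = 0"
        and x: "x \<in> {b / 2<..<b}"
      have "Gamma (\<alpha> + 1) > 0" using assms by (intro Gamma_real_pos) auto
      then have "fb_weight \<alpha> x > 0" using x assms by (auto simp: fb_weight_def)
      moreover have "(x - b / 2) * (b - x) > 0" using x by simp
      then have "bump b x > 0" by (simp add: bump_def)
      ultimately show False using * x assms by auto
    qed
    then have "{b / 2<..<b} \<in> null_sets lebesgue"
      by (subst AE_iff_null_sets) auto
    then show False
      using assms by (auto simp: null_sets_def)
  qed
  ultimately have "N > 0" by simp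
  then show thesis using eq that by blast
qed

section \<open>Relative density\<close>

lemma emeasure_fb_measure_interval:
  assumes "\<alpha> \<ge> 0" "0 \<le> u" "u \<le> v"
  shows "emeasure (fb_measure \<alpha>) {u..v} \<le> ennreal (fb_weight \<alpha> v * (v - u))"
proof -
  have sets: "{u..v} \<in> sets (lebesgue_on {0..})"
    using assms by (auto simp: sets_restrict_space_iff)
  have G: "Gamma (\<alpha> + 1) > 0" using assms by (intro Gamma_real_pos) auto
  have meas: "(\<lambda>x. ennreal (fb_weight \<alpha> x)) \<in> borel_measurable (lebesgue_on {0..})"
    by (intro measurable_compose[OF borel_measurable_lebesgue_on measurable_ennreal]) simp
  have "emeasure (fb_measure \<alpha>) {u..v}
      = (\<integral>\<^sup>+x. ennreal (fb_weight \<alpha> x) * indicator {u..v} x \<partial>lebesgue_on {0..})"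
    unfolding fb_measure_eq by (rule emeasure_density[OF meas sets])
  also have "\<dots> \<le> (\<integral>\<^sup>+x. ennreal (fb_weight \<alpha> v) * indicator {u..v} x \<partial>lebesgue_on {0..})"
  proof (rule nn_integral_mono)
    fix x
    have "fb_weight \<alpha> x \<le> fb_weight \<alpha> v" if "x \<in> {u..v}"
      using that assms G by (auto simp: fb_weight_def intro!: mult_left_mono divide_right_mono powr_mono2)
    then show "ennreal (fb_weight \<alpha> x) * indicator {u..v} x \<le> ennreal (fb_weight \<alpha> v) * indicator {u..v} x"
      by (auto simp: indicator_def intro: ennreal_leI)
  qed
  also have "\<dots> = ennreal (fb_weight \<alpha> v) * emeasure (lebesgue_on {0..}) {u..v}"
    using sets by (rule nn_integral_cmult_indicator)
  also have "emeasure (lebesgue_on {0..}) {u..v} = ennreal (v - u)"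
    using assms by (subst emeasure_restrict_space) auto
  finally show ?thesis
    using assms fb_weight_nonneg[OF assms(1)] by (simp add: ennreal_mult'')
qed

lemma measure_fb_measure_interval:
  assumes "\<alpha> \<ge> 0" "0 \<le> u" "u \<le> v"
  shows "measure (fb_measure \<alpha>) {u..v} \<le> fb_weight \<alpha> v * (v - u)"
  unfolding measure_def using emeasure_fb_measure_interval[OF assms] assms fb_weight_nonneg[OF assms(1)]
  by (intro enn2real_leI) auto

theorem lemma4p1:
  fixes \<alpha> b :: real and \<Omega> :: "real set"
  assumes "\<alpha> \<ge> 0" and "b > 0"
    and "\<Omega> \<subseteq> {0..}" and "\<Omega> \<in> sets lebesgue"
    and "\<exists>c>0. \<forall>f\<in>fb_Lp \<alpha> 2. fb_supp_within \<alpha> f {0..b} \<longrightarrow>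
           c * (LINT x|fb_measure \<alpha>. (cmod (f x))\<^sup>2) \<le> (LINT x:\<Omega>|fb_measure \<alpha>. (cmod (f x))\<^sup>2)"
  shows "relatively_dense \<alpha> \<Omega>"
proof -
  let ?M = "fb_measure \<alpha>" and ?m = "2 * \<alpha> + 1"
  let ?f = "\<lambda>x0 \<theta>. hankel \<alpha> (packet b (2 * pi * x0) \<theta>)"
  obtain c where c: "c > 0"
    "\<And>f. f \<in> fb_Lp \<alpha> 2 \<Longrightarrow> fb_supp_within \<alpha> f {0..b} \<Longrightarrow>
      c * (LINT x|?M. (cmod (f x))\<^sup>2) \<le> (LINT x:\<Omega>|?M. (cmod (f x))\<^sup>2)"
    using assms(5) by blast
  obtain T where T: "T > 0"
    "\<And>x0 \<theta>. x0 \<ge> 1 \<Longrightarrow> integrable ?M (\<lambda>x. ((x\<^sup>2 - x0\<^sup>2) * ?f x0 \<theta> x)\<^sup>2)"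
    "\<And>x0 \<theta>. x0 \<ge> 1 \<Longrightarrow> (LINT x|?M. ((x\<^sup>2 - x0\<^sup>2) * ?f x0 \<theta> x)\<^sup>2) \<le> T * x0\<^sup>2"
    using packet_concentration[OF assms(1,2)] by blast
  obtain D where D: "D > 0"
    "\<And>\<omega> \<theta> x. x > 0 \<Longrightarrow> x powr ?m * (hankel \<alpha> (packet b \<omega> \<theta>) x)\<^sup>2 \<le> D"
    using packet_decay[OF assms(1,2)] by blast
  obtain N where N: "N > 0"
    "\<And>\<omega>. (LINT x|?M. (hankel \<alpha> (packet b \<omega> 0) x)\<^sup>2)
      + (LINT x|?M. (hankel \<alpha> (packet b \<omega> (pi / 2)) x)\<^sup>2) = N"
    using packet_energy[OF assms(1,2)] by blast
  note plancherel = packet_plancherel[OF assms(1,2) continuous_bump(4)[OF assms(2)] bump_outside(4)[OF assms(2)]]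
  have \<Omega>: "\<Omega> \<in> sets ?M"
    using assms(3,4) by (simp add: sets_fb_measure sets_restrict_space_iff)
  \<comment> \<open>For this radius the two packets have at most half of \<open>c N\<close> at distance \<open>R\<close> or more from \<open>x0\<close>.\<close>
  define R where "R = 1 + 4 * T / (c * N)"
  have R: "R \<ge> 1" using T c N by (simp add: R_def)
  have RT: "2 * T / R\<^sup>2 \<le> c * N / 2"
  proof -
    have "4 * T \<le> R * (c * N)" using c N T by (simp add: R_def field_simps)
    also have "\<dots> \<le> R\<^sup>2 * (c * N)"
      using R c N by (intro mult_right_mono) (auto simp: power2_eq_square)
    finally show ?thesis using R by (simp add: field_simps)
  qed
  define E where "E = D * 2 powr ?m"
  have E: "E > 0" using D by (simp add: E_def)
  \<comment> \<open>Centres \<open>x0 \<ge> 2 R\<close> keep the points with \<open>\<bar>x - x0\<bar> < R\<close> above \<open>x0 / 2\<close>, where the pointwise bound is uniform.\<close>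
  have key: "c * (LINT x|?M. (?f x0 \<theta> x)\<^sup>2)
      \<le> E / x0 powr ?m * measure ?M (\<Omega> \<inter> {x0 - 2 * R..x0 + 2 * R}) + T / R\<^sup>2"
    if x0: "x0 \<ge> 2 * R" for x0 \<theta>
  proof -
    let ?J = "{x0 - 2 * R..x0 + 2 * R}"
    let ?F = "\<lambda>x. ((x\<^sup>2 - x0\<^sup>2) * ?f x0 \<theta> x)\<^sup>2"
    have x1: "x0 \<ge> 1" "x0 > 0" using x0 R by auto
    have \<Omega>J: "\<Omega> \<inter> ?J \<in> sets ?M"
    proof -
      have "?J \<in> sets ?M"
        using x0 R by (auto simp: sets_fb_measure sets_restrict_space_iff)
      with \<Omega> show ?thesis by (rule sets.Int)
    qed
    have "emeasure ?M (\<Omega> \<inter> ?J) \<le> emeasure ?M ?J"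
      using x0 R by (intro emeasure_mono) (auto simp: sets_fb_measure sets_restrict_space_iff)
    also have "\<dots> \<le> ennreal (fb_weight \<alpha> (x0 + 2 * R) * (x0 + 2 * R - (x0 - 2 * R)))"
      using x0 R by (intro emeasure_fb_measure_interval[OF assms(1)]) auto
    finally have fin: "emeasure ?M (\<Omega> \<inter> ?J) < \<infinity>"
      by (rule le_less_trans) simp
    have "(\<lambda>x. complex_of_real (?f x0 \<theta> x)) \<in> fb_Lp \<alpha> 2"
      by (intro of_real_in_fb_L2 plancherel)
    from c(2)[OF this packet_support[OF assms(1,2)]]
    have "c * (LINT x|?M. (?f x0 \<theta> x)\<^sup>2) \<le> (LINT x|?M. indicator \<Omega> x * (?f x0 \<theta> x)\<^sup>2)"
      by (simp add: set_lebesgue_integral_def)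
    also have "\<dots> \<le> (LINT x|?M. E / x0 powr ?m * indicator (\<Omega> \<inter> ?J) x + 1 / (R * x0)\<^sup>2 * ?F x)"
    proof (rule integral_mono)
      show "integrable ?M (\<lambda>x. indicator \<Omega> x * (?f x0 \<theta> x)\<^sup>2)"
        using integrable_mult_indicator[OF \<Omega> plancherel(3)] by simp
      show "integrable ?M (\<lambda>x. E / x0 powr ?m * indicator (\<Omega> \<inter> ?J) x + 1 / (R * x0)\<^sup>2 * ?F x)"
        using \<Omega>J fin T(2)[OF x1(1)]
        by (intro Bochner_Integration.integrable_add integrable_mult_right integrable_real_indicator) auto
      fix x assume "x \<in> space ?M"
      then have x: "x \<ge> 0" by simp
      show "indicator \<Omega> x * (?f x0 \<theta> x)\<^sup>2
          \<le> E / x0 powr ?m * indicator (\<Omega> \<inter> ?J) x + 1 / (R * x0)\<^sup>2 * ?F x"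
      proof (cases "\<bar>x - x0\<bar> < R")
        case True
        have "x0 / 2 \<le> x" using True x0 by auto
        then have "(x0 / 2) powr ?m * (?f x0 \<theta> x)\<^sup>2 \<le> x powr ?m * (?f x0 \<theta> x)\<^sup>2"
          using x1 assms(1) by (intro mult_right_mono powr_mono2) auto
        also have "\<dots> \<le> D"
          using \<open>x0 / 2 \<le> x\<close> x1 by (intro D(2)) auto
        finally have "(?f x0 \<theta> x)\<^sup>2 \<le> E / x0 powr ?m"
          using x1 by (simp add: E_def powr_divide field_simps)
        moreover have "x \<in> ?J" using True R by auto
        ultimately have "indicator \<Omega> x * (?f x0 \<theta> x)\<^sup>2 \<le> E / x0 powr ?m * indicator (\<Omega> \<inter> ?J) x"
          by (auto simp: indicator_def)
        then show ?thesis by (simp add: add_increasing2)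
      next
        case False
        have "R * x0 \<le> \<bar>x - x0\<bar> * (x + x0)"
          using False x x1 R by (intro mult_mono) auto
        also have "\<dots> = \<bar>x\<^sup>2 - x0\<^sup>2\<bar>"
          using x x1 by (simp add: power2_eq_square square_diff_square_factored abs_mult mult.commute)
        finally have "(R * x0)\<^sup>2 \<le> (x\<^sup>2 - x0\<^sup>2)\<^sup>2"
          using R x1 power_mono[of "R * x0" "\<bar>x\<^sup>2 - x0\<^sup>2\<bar>" 2] by simp
        then have "(R * x0)\<^sup>2 * (?f x0 \<theta> x)\<^sup>2 \<le> ?F x"
          unfolding power_mult_distrib[of "x\<^sup>2 - x0\<^sup>2"] by (rule mult_right_mono) auto
        moreover have "(R * x0)\<^sup>2 > 0" using R x1 by simp
        ultimately have "(?f x0 \<theta> x)\<^sup>2 \<le> 1 / (R * x0)\<^sup>2 * ?F x"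
          by (simp add: pos_le_divide_eq mult.commute)
        moreover have "indicator \<Omega> x * (?f x0 \<theta> x)\<^sup>2 \<le> (?f x0 \<theta> x)\<^sup>2"
          by (simp add: indicator_def)
        moreover have "0 \<le> E / x0 powr ?m * indicator (\<Omega> \<inter> ?J) x"
          using E by simp
        ultimately show ?thesis by linarith
      qed
    qed
    also have "\<dots> = E / x0 powr ?m * measure ?M (\<Omega> \<inter> ?J) + 1 / (R * x0)\<^sup>2 * (LINT x|?M. ?F x)"
    proof -
      have "integrable ?M (\<lambda>x. E / x0 powr ?m * indicator (\<Omega> \<inter> ?J) x)"
        using \<Omega>J fin by (intro integrable_mult_right integrable_real_indicator)
      moreover have "integrable ?M (\<lambda>x. 1 / (R * x0)\<^sup>2 * ?F x)"
        by (rule integrable_mult_right[OF T(2)[OF x1(1)]])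
      moreover have "(LINT x|?M. E / x0 powr ?m * indicator (\<Omega> \<inter> ?J) x) = E / x0 powr ?m * measure ?M (\<Omega> \<inter> ?J)"
        using sets.sets_into_space[OF \<Omega>J] by (simp add: Int_absorb2)
      moreover have "(LINT x|?M. 1 / (R * x0)\<^sup>2 * ?F x) = 1 / (R * x0)\<^sup>2 * (LINT x|?M. ?F x)"
        by (rule integral_mult_right_zero)
      ultimately show ?thesis
        by (simp only: Bochner_Integration.integral_add)
    qed
    also have "\<dots> \<le> E / x0 powr ?m * measure ?M (\<Omega> \<inter> ?J) + 1 / (R * x0)\<^sup>2 * (T * x0\<^sup>2)"
      by (intro add_left_mono mult_left_mono T(3) x1) simp
    also have "1 / (R * x0)\<^sup>2 * (T * x0\<^sup>2) = T / R\<^sup>2"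
      using x1 by (simp add: power_mult_distrib)
    finally show ?thesis .
  qed
  define W where "W = fb_weight \<alpha> 2 * (4 * R)"
  have W: "W > 0"
  proof -
    have "Gamma (\<alpha> + 1) > 0" using assms(1) by (intro Gamma_real_pos) auto
    then show ?thesis using R by (simp add: W_def fb_weight_def)
  qed
  define \<gamma> where "\<gamma> = c * N / (4 * E * W)"
  have "\<gamma> * measure ?M {x0 - 2 * R..x0 + 2 * R} \<le> measure ?M (\<Omega> \<inter> {x0 - 2 * R..x0 + 2 * R})"
    if x0: "x0 \<ge> 2 * R" for x0
  proof -
    let ?J = "{x0 - 2 * R..x0 + 2 * R}"
    have x1: "x0 > 0" using x0 R by auto
    have "c * N \<le> 2 * (E / x0 powr ?m * measure ?M (\<Omega> \<inter> ?J)) + 2 * T / R\<^sup>2"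
      using key[OF x0, of 0] key[OF x0, of "pi / 2"]
      unfolding N(2)[of "2 * pi * x0", symmetric] by (simp add: distrib_left)
    then have "c * N / 4 \<le> E / x0 powr ?m * measure ?M (\<Omega> \<inter> ?J)"
      using RT by linarith
    then have low: "c * N / (4 * E) * x0 powr ?m \<le> measure ?M (\<Omega> \<inter> ?J)"
      using E x1 by (simp add: field_simps)
    have "measure ?M ?J \<le> fb_weight \<alpha> (x0 + 2 * R) * (x0 + 2 * R - (x0 - 2 * R))"
      using x0 R by (intro measure_fb_measure_interval[OF assms(1)]) auto
    also have "\<dots> \<le> fb_weight \<alpha> (2 * x0) * (4 * R)"
    proof (rule mult_mono)
      have "Gamma (\<alpha> + 1) > 0" using assms(1) by (intro Gamma_real_pos) auto
      then show "fb_weight \<alpha> (x0 + 2 * R) \<le> fb_weight \<alpha> (2 * x0)"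
        using x0 R assms(1) by (auto simp: fb_weight_def intro!: mult_left_mono divide_right_mono powr_mono2)
    qed (use R fb_weight_nonneg[OF assms(1)] in auto)
    also have "\<dots> = W * x0 powr ?m"
      using x1 by (simp add: W_def fb_weight_def powr_mult)
    finally have "\<gamma> * measure ?M ?J \<le> \<gamma> * (W * x0 powr ?m)"
      using c N E W by (intro mult_left_mono) (auto simp: \<gamma>_def)
    also have "\<dots> = c * N / (4 * E) * x0 powr ?m"
      using W by (simp add: \<gamma>_def)
    finally show ?thesis using low by linarith
  qed
  moreover have "\<gamma> > 0" using c N E W by (simp add: \<gamma>_def)
  ultimately show ?thesis
    unfolding relatively_dense_def using R by (intro exI[of _ \<gamma>] exI[of _ "2 * R"] conjI) auto
qed

end
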